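(* Let $n\ge 1$ and let $\{A_j\}_{j=0}^{n}$ be positive operators on a finite-dimensional Hilbert space $\mathcal{H}$. Assume that for each $j\in\{1,\dots,n\}$ there is an integer $k_j>0$ such that $I\ge A_j\ge (1/k_j)I$. Let $k=\prod_{j=1}^{n}k_j$. Then there exist positive operators $\{B_j\}_{j=0}^{n}$ on $\oplus^{k}\mathcal{H}$ such that: (a) $\{B_j\}_{j=0}^{n}$ is a monotone family of positive operators; (b) $\{B_j\}_{j=0}^{n}$ totally dilates $\{A_j\}_{j=0}^{n}$. Moreover, a suitable choice is $B_j=A_j(k'_j)\langle k_j\rangle[k''_j]$ for $0\le j\le n$, where $k_0=1$, $k'_j=\prod_{l=0}^{j-1}k_l$ and $k''_j=\prod_{l=j+1}^{n}k_l$ (empty products being $1$).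
   Context: "Positive" means positive semi-definite. A family $\{X_j\}_{j=0}^{n}$ of positive operators on a $d$-dimensional Hilbert space is monotone if there is a single orthonormal basis $\{e_i\}_{i=1}^{d}$ such that $X_j=\sum_{i=1}^{d}\mu_i(X_j)\,e_i\otimes e_i$ for every $j$, where $\mu_1(X_j)\ge\mu_2(X_j)\ge\cdots$ are the singular values (here the eigenvalues) of $X_j$ in decreasing order counted with multiplicity, and $e_i\otimes e_i$ is the rank one orthogonal projection onto the span of $e_i$. $\oplus^{k}\mathcal{H}$ denotes the direct sum $\mathcal{H}\oplus\cdots\oplus\mathcal{H}$ with $k$ terms. A family $\{B_j\}_{j=0}^n$ of operators on $\oplus^k\mathcal{H}$ totally dilates a family $\{A_j\}_{j=0}^n$ of operators on $\mathcal{H}$ if, simultaneously for all $j$, $B_j$ can be written as a $k\times k$ block operator matrix all of whose diagonal blocks equal $A_j$; that is, there are isometries $V_1,\dots,V_k:\mathcal{H}\to\oplus^k\mathcal{H}$ with mutually orthogonal ranges spanning $\oplus^k\mathcal{H}$ such that $V_i^*B_jV_i=A_j$ for all $i$ and $j$. For an operator $A$ on a space $\mathcal{K}$ and an integer $m>0$, define the following operators on $\oplus^m\mathcal{K}$, written as $m\times m$ block matrices: $A(m)$ has all diagonal blocks equal to $A$ and all off-diagonal blocks $0$ (i.e. $A(m)=A\otimes I_m$); $A[m]$ has all blocks equal to $A$ (i.e. $A[m]=A\otimes E_m$, with $E_m$ the $m\times m$ matrix with all entries $1$); for $m>1$, $A\langle m\rangle$ has all diagonal blocks equal to $A$ and all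 off-diagonal blocks equal to $\frac{1}{m-1}(I-A)$; for $m=1$, $A\langle 1\rangle=A$. An expression such as $A(p)\langle q\rangle[r]$ is read from left to right: first form $B=A(p)$, then $C=B\langle q\rangle$, then $C[r]$; iterated direct sums are identified in the natural way, e.g. $\oplus^q(\oplus^p\mathcal{H})=\oplus^{pq}\mathcal{H}$. *)

theory Defs
  imports
    "Jordan_Normal_Form.Schur_Decomposition"
    "Jordan_Normal_Form.Char_Poly"
    "HOL-Computational_Algebra.Computational_Algebra"
begin

text \<open>
  A \<open>d\<close>-dimensional Hilbert space is \<open>\<complex>\<^sup>d\<close>, i.e. \<open>carrier_vec d\<close> over the complex numbers with
  the inner product \<open>v \<bullet>c w\<close>, and operators on it are elements of \<open>carrier_mat d d\<close>.
  The adjoint is \<open>mat_adjoint\<close> (the conjugate transpose).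
\<close>

definition positive_op :: "nat \<Rightarrow> complex mat \<Rightarrow> bool" where
  "positive_op d A \<longleftrightarrow> A \<in> carrier_mat d d \<and> mat_adjoint A = A \<and>
     (\<forall>v\<in>carrier_vec d. 0 \<le> Re ((A *\<^sub>v v) \<bullet>c v))"

definition loewner_le :: "nat \<Rightarrow> complex mat \<Rightarrow> complex mat \<Rightarrow> bool" where
  "loewner_le d A B \<longleftrightarrow> A \<in> carrier_mat d d \<and> B \<in> carrier_mat d d \<and> positive_op d (B - A)"

text \<open>
  Singular values in decreasing order, counted with multiplicity: the square roots of the
  eigenvalues of \<open>A\<^sup>*A\<close> (which are real and nonnegative, so taking \<open>Re\<close> loses nothing).
  The list is indexed from \<open>0\<close>.
\<close>

definition singular_values :: "complex mat \<Rightarrow> real list" where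
  "singular_values A =
     rev (sorted_list_of_multiset
       (image_mset (\<lambda>z. sqrt (Re z)) (proots (char_poly (mat_adjoint A * A)))))"

definition orthonormal_basis :: "nat \<Rightarrow> (nat \<Rightarrow> complex vec) \<Rightarrow> bool" where
  "orthonormal_basis d e \<longleftrightarrow>
     (\<forall>i<d. e i \<in> carrier_vec d) \<and>
     (\<forall>i<d. \<forall>l<d. e i \<bullet>c e l = (if i = l then 1 else 0)) \<and>
     vectorspace.basis class_ring (module_vec TYPE(complex) d) (e ` {..<d})"

text \<open>The operator \<open>x \<mapsto> \<langle>x, v\<rangle> v\<close>; for a unit vector, the projection onto its span.\<close>

definition rank_one_proj :: "complex vec \<Rightarrow> complex mat" where
  "rank_one_proj v = mat (dim_vec v) (dim_vec v) (\<lambda>(a, b). v $ a * cnj (v $ b))"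

definition monotone_family :: "nat \<Rightarrow> nat \<Rightarrow> (nat \<Rightarrow> complex mat) \<Rightarrow> bool" where
  "monotone_family d n X \<longleftrightarrow>
     (\<forall>j\<le>n. positive_op d (X j)) \<and>
     (\<exists>e. orthonormal_basis d e \<and>
        (\<forall>j\<le>n. X j = finsum (module_mat TYPE(complex) d d)
           (\<lambda>i. complex_of_real (singular_values (X j) ! i) \<cdot>\<^sub>m rank_one_proj (e i)) {..<d}))"

text \<open>
  The direct sum of \<open>m\<close> copies of \<open>\<complex>\<^sup>D\<close> is \<open>\<complex>\<^bsup>m * D\<^esup>\<close>, where coordinate \<open>b * D + a\<close>
  (with \<open>a < D\<close>) is coordinate \<open>a\<close> of summand \<open>b < m\<close>. With this convention the natural
  identifications of iterated direct sums are literal equalities.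
\<close>

definition totally_dilates ::
    "nat \<Rightarrow> nat \<Rightarrow> nat \<Rightarrow> (nat \<Rightarrow> complex mat) \<Rightarrow> (nat \<Rightarrow> complex mat) \<Rightarrow> bool" where
  "totally_dilates d k n B A \<longleftrightarrow>
     (\<forall>j\<le>n. A j \<in> carrier_mat d d \<and> B j \<in> carrier_mat (k * d) (k * d)) \<and>
     (\<exists>V. (\<forall>i<k. V i \<in> carrier_mat (k * d) d \<and> mat_adjoint (V i) * V i = 1\<^sub>m d) \<and>
        (\<forall>i<k. \<forall>l<k. i \<noteq> l \<longrightarrow>
           (\<forall>x\<in>carrier_vec d. \<forall>y\<in>carrier_vec d. (V i *\<^sub>v x) \<bullet>c (V l *\<^sub>v y) = 0)) \<and>
        LinearCombinations.module.span class_ring (module_vec TYPE(complex) (k * d))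
          (\<Union>i<k. (\<lambda>x. V i *\<^sub>v x) ` carrier_vec d) = carrier_vec (k * d) \<and>
        (\<forall>i<k. \<forall>j\<le>n. mat_adjoint (V i) * B j * V i = A j))"

definition block_matrix :: "nat \<Rightarrow> nat \<Rightarrow> (nat \<Rightarrow> nat \<Rightarrow> complex mat) \<Rightarrow> complex mat" where
  "block_matrix m D F =
     mat (m * D) (m * D) (\<lambda>(r, c). F (r div D) (c div D) $$ (r mod D, c mod D))"

text \<open>\<open>A(m)\<close>, \<open>A[m]\<close> and \<open>A\<langle>m\<rangle>\<close>, in this order.\<close>

definition amp_round :: "complex mat \<Rightarrow> nat \<Rightarrow> complex mat" where
  "amp_round A m = block_matrix m (dim_row A)
     (\<lambda>b c. if b = c then A else 0\<^sub>m (dim_row A) (dim_row A))"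

definition amp_square :: "complex mat \<Rightarrow> nat \<Rightarrow> complex mat" where
  "amp_square A m = block_matrix m (dim_row A) (\<lambda>b c. A)"

definition amp_angle :: "complex mat \<Rightarrow> nat \<Rightarrow> complex mat" where
  "amp_angle A m = (if m = 1 then A else block_matrix m (dim_row A)
     (\<lambda>b c. if b = c then A else (1 / (of_nat m - 1)) \<cdot>\<^sub>m (1\<^sub>m (dim_row A) - A)))"

end

theory Submission
  imports Defs "Jordan_Normal_Form.Spectral_Radius"
begin

text \<open>
  Let \<open>E\<close> be the \<open>m \<times> m\<close> matrix of ones and \<open>u\<close> the vector of ones. Then \<open>X[m]\<close> acts as \<open>m X\<close>
  on \<open>\<H> \<otimes> u\<close> and vanishes on its orthogonal complement, while \<open>Y\<langle>m\<rangle>\<close> is the identity on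
  \<open>\<H> \<otimes> u\<close> and acts as \<open>(m Y - I)/(m - 1)\<close>, tensored with the identity, on the complement;
  \<open>I/m \<le> Y \<le> I\<close> says exactly that the latter has its spectrum in \<open>[0, 1]\<close>. Hence a common
  eigenbasis with decreasing eigenvalues of a family \<open>X\<^sub>j\<close> on \<open>\<H>\<close> induces one of the family of the
  \<open>X\<^sub>j[m]\<close> and \<open>Y\<langle>m\<rangle>\<close>, by completing it with eigenvectors of \<open>Y\<langle>m\<rangle>\<close>. This is the induction step
  on \<open>n\<close>, since passing from \<open>n\<close> to \<open>n + 1\<close> replaces \<open>B\<^sub>j\<close> by \<open>B\<^sub>j[k\<^sub>n\<^sub>+\<^sub>1]\<close>. The coordinate
  embeddings witness the total dilation.
\<close>

no_notation fps_nth (infixl "$" 75)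

subsection \<open>Orthonormal families and eigenvectors of self-adjoint matrices\<close>

lemma cscalar_prod_sum:
  assumes "w \<in> carrier_vec D"
  shows "v \<bullet>c w = (\<Sum>a<D. v $ a * cnj (w $ a))"
  using assms by (auto simp: scalar_prod_def atLeast0LessThan intro!: sum.cong)

lemma mult_mat_vec_sum:
  assumes "B \<in> carrier_mat m D" "v \<in> carrier_vec D" "a < m"
  shows "(B *\<^sub>v v) $ a = (\<Sum>b<D. B $$ (a, b) * v $ b)"
  using assms by (auto simp: scalar_prod_def atLeast0LessThan intro!: sum.cong)

lemma mat_adjoint_dims [simp]:
  "dim_row (mat_adjoint A) = dim_col A" "dim_col (mat_adjoint A) = dim_row A"
  by (auto simp: mat_adjoint_def)

lemma mat_adjoint_index:
  fixes A :: "complex mat"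
  assumes "i < dim_col A" "j < dim_row A"
  shows "mat_adjoint A $$ (i, j) = cnj (A $$ (j, i))"
  using assms by (simp add: mat_adjoint_def mat_of_rows_def)

lemma self_adjointI:
  fixes B :: "complex mat"
  assumes "B \<in> carrier_mat D D"
    and "\<And>a b. a < D \<Longrightarrow> b < D \<Longrightarrow> B $$ (a, b) = cnj (B $$ (b, a))"
  shows "mat_adjoint B = B"
proof (rule eq_matI)
  fix i j assume "i < dim_row B" "j < dim_col B"
  then show "mat_adjoint B $$ (i, j) = B $$ (i, j)"
    using assms(1) assms(2)[of i j] by (simp add: mat_adjoint_index)
qed (use assms(1) in auto)

lemma self_adjointD:
  fixes B :: "complex mat"
  assumes "mat_adjoint B = B" "B \<in> carrier_mat D D" "a < D" "b < D"
  shows "B $$ (a, b) = cnj (B $$ (b, a))"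
proof -
  have "mat_adjoint B $$ (a, b) = cnj (B $$ (b, a))"
    using assms(2-4) by (intro mat_adjoint_index) auto
  then show ?thesis unfolding assms(1) .
qed

lemma self_adjoint_cscalar_prod:
  fixes B :: "complex mat"
  assumes "mat_adjoint B = B" "B \<in> carrier_mat D D" "v \<in> carrier_vec D" "w \<in> carrier_vec D"
  shows "(B *\<^sub>v v) \<bullet>c w = v \<bullet>c (B *\<^sub>v w)"
proof -
  have "(B *\<^sub>v v) \<bullet>c w = (\<Sum>a<D. \<Sum>b<D. B $$ (a, b) * v $ b * cnj (w $ a))"
    using assms by (simp add: cscalar_prod_sum[of _ D] mult_mat_vec_sum[of B D D] sum_distrib_right
        del: index_mult_mat_vec)
  also have "\<dots> = (\<Sum>b<D. \<Sum>a<D. B $$ (a, b) * v $ b * cnj (w $ a))"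
    by (rule sum.swap)
  also have "\<dots> = (\<Sum>b<D. v $ b * cnj (\<Sum>a<D. B $$ (b, a) * w $ a))"
  proof (rule sum.cong)
    fix b assume b: "b \<in> {..<D}"
    have "(\<Sum>a<D. B $$ (a, b) * v $ b * cnj (w $ a)) = (\<Sum>a<D. v $ b * cnj (B $$ (b, a) * w $ a))"
    proof (rule sum.cong)
      fix a assume "a \<in> {..<D}"
      then have "B $$ (a, b) = cnj (B $$ (b, a))"
        using b by (intro self_adjointD[OF assms(1,2)]) auto
      then show "B $$ (a, b) * v $ b * cnj (w $ a) = v $ b * cnj (B $$ (b, a) * w $ a)"
        by simp
    qed simp
    then show "(\<Sum>a<D. B $$ (a, b) * v $ b * cnj (w $ a)) = v $ b * cnj (\<Sum>a<D. B $$ (b, a) * w $ a)"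
      by (simp add: sum_distrib_left)
  qed simp
  also have "\<dots> = v \<bullet>c (B *\<^sub>v w)"
    using assms by (simp add: cscalar_prod_sum[of _ D] mult_mat_vec_sum[of B D D]
        del: index_mult_mat_vec)
  finally show ?thesis .
qed

lemma cscalar_prod_swap:
  fixes v w :: "complex vec"
  assumes "v \<in> carrier_vec D" "w \<in> carrier_vec D"
  shows "v \<bullet>c w = cnj (w \<bullet>c v)"
  using assms by (simp add: cscalar_prod_sum[of _ D] mult.commute)

lemma cscalar_prod_smult_right:
  fixes v w :: "complex vec"
  assumes "v \<in> carrier_vec D" "w \<in> carrier_vec D"
  shows "v \<bullet>c (c \<cdot>\<^sub>v w) = cnj c * (v \<bullet>c w)"
  using assms by (simp add: cscalar_prod_sum[of _ D] sum_distrib_left algebra_simps)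

lemma cscalar_prod_smult_left:
  fixes v w :: "complex vec"
  assumes "v \<in> carrier_vec D" "w \<in> carrier_vec D"
  shows "(c \<cdot>\<^sub>v v) \<bullet>c w = c * (v \<bullet>c w)"
  using assms by (simp add: cscalar_prod_sum[of _ D] sum_distrib_left algebra_simps)

lemma cscalar_prod_self:
  fixes v :: "complex vec"
  assumes "v \<in> carrier_vec D"
  shows "v \<bullet>c v = of_real (\<Sum>a<D. (cmod (v $ a))\<^sup>2)"
  using assms by (simp add: cscalar_prod_sum[of _ D] flip: complex_norm_square)

lemma self_adjoint_eigenvalue_real:
  fixes B :: "complex mat"
  assumes "mat_adjoint B = B" "B \<in> carrier_mat D D" "v \<in> carrier_vec D" "v \<noteq> 0\<^sub>v D"
    and "B *\<^sub>v v = c \<cdot>\<^sub>v v"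
  shows "c = of_real (Re c)"
proof -
  have "c * (v \<bullet>c v) = cnj c * (v \<bullet>c v)"
    using self_adjoint_cscalar_prod[OF assms(1-3,3)] assms
    by (simp add: cscalar_prod_smult_right[of _ D])
  moreover have "v \<bullet>c v \<noteq> 0" using assms by simp
  ultimately show ?thesis by (metis Reals_cnj_iff mult_cancel_right of_real_Re)
qed

definition orthonormal_family :: "nat \<Rightarrow> nat \<Rightarrow> (nat \<Rightarrow> complex vec) \<Rightarrow> bool" where
  "orthonormal_family D p e \<longleftrightarrow>
     (\<forall>i<p. e i \<in> carrier_vec D) \<and>
     (\<forall>i<p. \<forall>l<p. e i \<bullet>c e l = (if i = l then 1 else 0))"

text \<open>Orthonormality says that the matrix \<open>E\<close> with columns \<open>e i\<close> has
  its adjoint \<open>F\<close> as a left inverse. A left inverse of a square matrix is a right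
  inverse, and the entries of \<open>E * F\<close> are the sums in question.\<close>

lemma orthonormal_family_complete:
  assumes "orthonormal_family D D e" "a < D" "b < D"
  shows "(\<Sum>i<D. e i $ a * cnj (e i $ b)) = (if a = b then 1 else 0)"
proof -
  define E where "E = mat D D (\<lambda>(a, i). e i $ a)"
  define F where "F = mat D D (\<lambda>(i, a). cnj (e i $ a))"
  have EF: "E \<in> carrier_mat D D" "F \<in> carrier_mat D D" by (auto simp: E_def F_def)
  have "F * E = 1\<^sub>m D"
  proof (rule eq_matI)
    fix i l assume *: "i < dim_row (1\<^sub>m D)" "l < dim_col (1\<^sub>m D)"
    then have "e i \<in> carrier_vec D" using assms(1) by (simp add: orthonormal_family_def)
    then have "(F * E) $$ (i, l) = e l \<bullet>c e i"
      using * unfolding cscalar_prod_sum[OF \<open>e i \<in> carrier_vec D\<close>]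
      by (simp add: E_def F_def scalar_prod_def atLeast0LessThan mult.commute)
    then show "(F * E) $$ (i, l) = 1\<^sub>m D $$ (i, l)"
      using * assms(1) by (auto simp: orthonormal_family_def)
  qed (auto simp: E_def F_def)
  then have "E * F = 1\<^sub>m D" by (rule mat_mult_left_right_inverse[OF EF(2,1)])
  then have "(E * F) $$ (a, b) = (if a = b then 1 else 0)" using assms by simp
  moreover have "(E * F) $$ (a, b) = (\<Sum>i<D. e i $ a * cnj (e i $ b))"
    using assms by (auto simp: E_def F_def scalar_prod_def atLeast0LessThan)
  ultimately show ?thesis by simp
qed

lemma orthonormal_family_expansion:
  assumes "orthonormal_family D D e" "v \<in> carrier_vec D" "a < D"
  shows "v $ a = (\<Sum>i<D. (v \<bullet>c e i) * e i $ a)"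
proof -
  have "(\<Sum>i<D. (v \<bullet>c e i) * e i $ a) = (\<Sum>i<D. \<Sum>b<D. v $ b * (e i $ a * cnj (e i $ b)))"
    using assms by (auto simp: orthonormal_family_def cscalar_prod_sum[of _ D] sum_distrib_left
        sum_distrib_right algebra_simps intro!: sum.cong)
  also have "\<dots> = (\<Sum>b<D. v $ b * (\<Sum>i<D. e i $ a * cnj (e i $ b)))"
    by (subst sum.swap) (simp add: sum_distrib_left)
  also have "\<dots> = (\<Sum>b<D. if a = b then v $ b else 0)"
    using orthonormal_family_complete[OF assms(1) assms(3)] by (intro sum.cong) auto
  also have "\<dots> = v $ a" using assms by simp
  finally show ?thesis by simp
qed

lemma orthonormal_family_eqI:
  assumes "orthonormal_family D D e" "v \<in> carrier_vec D" "w \<in> carrier_vec D"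
    and "\<And>i. i < D \<Longrightarrow> v \<bullet>c e i = w \<bullet>c e i"
  shows "v = w"
proof (rule eq_vecI)
  fix a assume "a < dim_vec w"
  then show "v $ a = w $ a"
    using assms orthonormal_family_expansion[OF assms(1), of _ a] by simp
qed (use assms in auto)

text \<open>Fewer than \<open>D\<close> linear conditions on \<open>D\<close> unknowns have a
  nonzero solution: the conjugated \<open>e i\<close>, padded with zero rows, form a singular square
  matrix, and a kernel vector of it is orthogonal to every \<open>e i\<close>.\<close>

lemma exists_orthogonal_vector:
  fixes e :: "nat \<Rightarrow> complex vec"
  assumes "p < D" "\<And>i. i < p \<Longrightarrow> e i \<in> carrier_vec D"
  obtains v where "v \<in> carrier_vec D" "v \<noteq> 0\<^sub>v D" "\<And>i. i < p \<Longrightarrow> v \<bullet>c e i = 0"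
proof -
  define c where "c = (\<lambda>i. if i < p then conjugate (e i) else 0\<^sub>v D)"
  define M where "M = mat\<^sub>r D D (\<lambda>i. if i = p then 0\<^sub>v D else c i)"
  have c: "c i \<in> carrier_vec D" for i using assms by (auto simp: c_def)
  have M: "M \<in> carrier_mat D D" by (simp add: M_def)
  have "det M = 0" unfolding M_def using assms(1) c by (intro det_row_0) auto
  then obtain v where v: "v \<in> carrier_vec D" "v \<noteq> 0\<^sub>v D" "M *\<^sub>v v = 0\<^sub>v D"
    using det_0_iff_vec_prod_zero[OF M] by auto
  have "v \<bullet>c e i = 0" if "i < p" for i
  proof -
    have "i < D" using that assms by simp
    then have "(M *\<^sub>v v) $ i = c i \<bullet> v"
      using that c by (simp add: M_def)
    then show ?thesis
      using v \<open>i < D\<close> that assms(2)[OF that] by (simp add: c_def conjugate_vec_sprod_comm[of _ D])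
  qed
  with v show ?thesis using that by blast
qed

lemma exists_unit_multiple:
  fixes v :: "complex vec"
  assumes "v \<in> carrier_vec D" "v \<noteq> 0\<^sub>v D"
  obtains c where "c \<noteq> 0" "(c \<cdot>\<^sub>v v) \<bullet>c (c \<cdot>\<^sub>v v) = 1"
proof -
  define s where "s = (\<Sum>a<D. (cmod (v $ a))\<^sup>2)"
  have vv: "v \<bullet>c v = of_real s" unfolding s_def by (rule cscalar_prod_self[OF assms(1)])
  have "v \<bullet>c v \<noteq> 0" using assms by simp
  moreover have "s \<ge> 0" by (simp add: s_def sum_nonneg)
  ultimately have "s > 0" using vv by auto
  define c :: complex where "c = of_real (1 / sqrt s)"
  have "c * cnj c * of_real s = 1"
    using \<open>s > 0\<close> by (simp add: c_def flip: of_real_mult)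
  moreover have "(c \<cdot>\<^sub>v v) \<bullet>c (c \<cdot>\<^sub>v v) = c * cnj c * (v \<bullet>c v)"
    using assms by (simp add: cscalar_prod_smult_right[of _ D])
  ultimately have "(c \<cdot>\<^sub>v v) \<bullet>c (c \<cdot>\<^sub>v v) = 1" using vv by simp
  moreover have "c \<noteq> 0" using \<open>s > 0\<close> by (simp add: c_def)
  ultimately show ?thesis using that by blast
qed

lemma orthonormal_family_Suc:
  assumes "orthonormal_family D p e" "v \<in> carrier_vec D" "v \<bullet>c v = 1"
    and "\<And>i. i < p \<Longrightarrow> v \<bullet>c e i = 0"
  shows "orthonormal_family D (Suc p) (e(p := v))"
proof -
  have "e i \<bullet>c v = 0" if "i < p" for i
    using assms that cscalar_prod_swap[of "e i" D v] by (auto simp: orthonormal_family_def)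
  then show ?thesis using assms by (auto simp: orthonormal_family_def less_Suc_eq)
qed

lemma orthonormal_family_extend:
  assumes "orthonormal_family D p e" "p \<le> D"
  obtains g where "orthonormal_family D D g" "\<And>i. i < p \<Longrightarrow> g i = e i"
proof -
  have "\<exists>g. orthonormal_family D q g \<and> (\<forall>i<p. g i = e i)" if "p \<le> q" "q \<le> D" for q
    using that
  proof (induction q rule: dec_induct)
    case base
    then show ?case using assms by blast
  next
    case (step q)
    then obtain g where g: "orthonormal_family D q g" "\<forall>i<p. g i = e i" by auto
    obtain v where v: "v \<in> carrier_vec D" "v \<noteq> 0\<^sub>v D" "\<And>i. i < q \<Longrightarrow> v \<bullet>c g i = 0"
      using exists_orthogonal_vector[of q D g] g step by (auto simp: orthonormal_family_def)
    obtain c where c: "(c \<cdot>\<^sub>v v) \<bullet>c (c \<cdot>\<^sub>v v) = 1" using exists_unit_multiple v(1,2) by blast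
    have "orthonormal_family D (Suc q) (g(q := c \<cdot>\<^sub>v v))"
      using v c g by (intro orthonormal_family_Suc) (auto simp: orthonormal_family_def)
    moreover have "\<forall>i<p. (g(q := c \<cdot>\<^sub>v v)) i = e i" using g step by auto
    ultimately show ?case by blast
  qed
  then show ?thesis using that assms(2) by blast
qed

text \<open>The restriction of \<open>B\<close> to the orthogonal complement of the given eigenvectors is
  represented by the matrix \<open>T\<close> in an orthonormal basis of that complement.\<close>

lemma exists_orthogonal_eigenvector:
  fixes B :: "complex mat"
  assumes "mat_adjoint B = B" "B \<in> carrier_mat D D"
    and e: "orthonormal_family D p e" "p < D"
    and eig: "\<And>i. i < p \<Longrightarrow> B *\<^sub>v e i = c i \<cdot>\<^sub>v e i"
  obtains v \<mu> where "v \<in> carrier_vec D" "v \<noteq> 0\<^sub>v D" "B *\<^sub>v v = \<mu> \<cdot>\<^sub>v v"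
    "\<And>i. i < p \<Longrightarrow> v \<bullet>c e i = 0"
proof -
  obtain g where g: "orthonormal_family D D g" "\<And>i. i < p \<Longrightarrow> g i = e i"
    using orthonormal_family_extend[OF e(1)] e(2) by auto
  have gc: "g i \<in> carrier_vec D" if "i < D" for i using g that by (auto simp: orthonormal_family_def)
  have go: "g i \<bullet>c g l = (if i = l then 1 else 0)" if "i < D" "l < D" for i l
    using g that by (auto simp: orthonormal_family_def)
  define m where "m = D - p"
  define T where "T = mat m m (\<lambda>(i, l). (B *\<^sub>v g (p + l)) \<bullet>c g (p + i))"
  have T: "T \<in> carrier_mat m m" "m > 0" using e by (auto simp: T_def m_def)
  then obtain \<mu> where "eigenvalue T \<mu>"
    using spectrum_non_empty[OF T] by (auto simp: spectrum_def)
  then obtain x where x: "x \<in> carrier_vec m" "x \<noteq> 0\<^sub>v m" "T *\<^sub>v x = \<mu> \<cdot>\<^sub>v x"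
    using T by (auto simp: eigenvalue_def eigenvector_def)
  \<comment> \<open>\<open>F\<close> carries coordinates with respect to
    \<open>g p, ..., g (D - 1)\<close> back to the whole space, so \<open>v\<close> is the vector of
    the complement with coordinates \<open>x\<close>.\<close>
  define F where "F = mat D m (\<lambda>(a, l). g (p + l) $ a)"
  define v where "v = F *\<^sub>v x"
  have F: "F \<in> carrier_mat D m" by (simp add: F_def)
  have v: "v \<in> carrier_vec D" using F x by (simp add: v_def)
  have coeff: "v \<bullet>c w = (\<Sum>l<m. x $ l * (g (p + l) \<bullet>c w))" if "w \<in> carrier_vec D" for w
  proof -
    have "v \<bullet>c w = (\<Sum>a<D. \<Sum>l<m. x $ l * (g (p + l) $ a * cnj (w $ a)))"
      unfolding cscalar_prod_sum[OF that] v_def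
    proof (rule sum.cong)
      fix a assume "a \<in> {..<D}"
      then have "a < D" by simp
      then show "(F *\<^sub>v x) $ a * cnj (w $ a) = (\<Sum>l<m. x $ l * (g (p + l) $ a * cnj (w $ a)))"
        unfolding mult_mat_vec_sum[OF F x(1) \<open>a < D\<close>] sum_distrib_right
        by (intro sum.cong) (auto simp: F_def)
    qed simp
    also have "\<dots> = (\<Sum>l<m. x $ l * (g (p + l) \<bullet>c w))"
      using that by (subst sum.swap) (simp add: sum_distrib_left cscalar_prod_sum[of _ D])
    finally show ?thesis .
  qed
  have low: "v \<bullet>c g i = 0" if "i < p" for i
    using that e coeff[OF gc, of i] go by (auto simp: m_def intro!: sum.neutral)
  have high: "v \<bullet>c g (p + i) = x $ i" if "i < m" for i
  proof -
    have "p + i < D" using that by (simp add: m_def)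
    have "v \<bullet>c g (p + i) = (\<Sum>l<m. if l = i then x $ l else 0)"
      unfolding coeff[OF gc[OF \<open>p + i < D\<close>]]
    proof (rule sum.cong)
      fix l assume "l \<in> {..<m}"
      then show "x $ l * (g (p + l) \<bullet>c g (p + i)) = (if l = i then x $ l else 0)"
        using go[of "p + l" "p + i"] \<open>p + i < D\<close> by (simp add: m_def)
    qed simp
    then show ?thesis using that by simp
  qed
  have Bv: "(B *\<^sub>v v) \<bullet>c g i = v \<bullet>c (B *\<^sub>v g i)" if "i < D" for i
    using self_adjoint_cscalar_prod assms v gc that by auto
  have "B *\<^sub>v v = \<mu> \<cdot>\<^sub>v v"
  \<comment> \<open>Coefficients are compared in the basis \<open>g\<close>. For
    \<open>i < p\<close> both vanish, because \<open>B\<close> is self-adjoint and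
    \<open>g i\<close> is an eigenvector orthogonal to \<open>v\<close>; for the other
    \<open>i\<close> the equation is row \<open>i - p\<close> of
    \<open>T *\<^sub>v x = \<mu> \<cdot>\<^sub>v x\<close>.\<close>
  proof (rule orthonormal_family_eqI[OF g(1)])
    fix i assume i: "i < D"
    show "(B *\<^sub>v v) \<bullet>c g i = (\<mu> \<cdot>\<^sub>v v) \<bullet>c g i"
    proof (cases "i < p")
      case True
      then show ?thesis
        using Bv[OF i] low[OF True] v gc[OF i] eig[OF True] g(2)[OF True]
        by (simp add: cscalar_prod_smult_right[of _ D])
    next
      case False
      then obtain i' where i': "i = p + i'" "i' < m"
        using i by (metis add_less_cancel_left le_add_diff_inverse m_def not_less order_less_imp_le e(2))
      have "(B *\<^sub>v v) \<bullet>c g i = (\<Sum>l<m. x $ l * ((B *\<^sub>v g (p + l)) \<bullet>c g i))"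
        using Bv[OF i] coeff[of "B *\<^sub>v g i"] assms(2) gc i
          self_adjoint_cscalar_prod[OF assms(1,2), of "g (p + _)" "g i"]
        by (auto simp: m_def intro!: sum.cong)
      also have "\<dots> = (T *\<^sub>v x) $ i'"
        using i' by (subst mult_mat_vec_sum[OF T(1) x(1)]) (auto simp: T_def intro!: sum.cong)
      also have "\<dots> = \<mu> * x $ i'" using x i' by simp
      finally show ?thesis using i' high v gc[OF i] by simp
    qed
  qed (use v assms in auto)
  moreover have "v \<noteq> 0\<^sub>v D"
  proof
    assume "v = 0\<^sub>v D"
    then have "x $ i = 0" if "i < m" for i
      using high[OF that] gc[of "p + i"] that by (simp add: m_def)
    then have "x = 0\<^sub>v m" using x(1) by (intro eq_vecI) auto
    then show False using x by simp
  qed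
  ultimately show ?thesis using that[of v \<mu>] v low g(2) by auto
qed

text \<open>The prescribed eigenvectors come first, in their given order. Each further one is chosen
  greedily, with the largest eigenvalue occurring among eigenvectors orthogonal to all earlier
  choices. Only this tail is claimed to be sorted; how it compares with the prescribed part is
  settled where the lemma is applied.\<close>

lemma sorted_eigenbasis_extension:
  fixes B :: "complex mat" and \<nu> :: "nat \<Rightarrow> real"
  assumes B: "mat_adjoint B = B" "B \<in> carrier_mat D D"
    and e: "orthonormal_family D p e" "p \<le> D"
    and eig: "\<And>i. i < p \<Longrightarrow> B *\<^sub>v e i = of_real (\<nu> i) \<cdot>\<^sub>v e i"
  obtains g \<mu> where "orthonormal_family D D g" "\<And>i. i < p \<Longrightarrow> g i = e i \<and> \<mu> i = \<nu> i"
    "\<And>i. i < D \<Longrightarrow> B *\<^sub>v g i = of_real (\<mu> i) \<cdot>\<^sub>v g i"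
    "\<And>i l. p \<le> i \<Longrightarrow> i \<le> l \<Longrightarrow> l < D \<Longrightarrow> \<mu> l \<le> \<mu> i"
proof -
  \<comment> \<open>The candidates at stage \<open>q\<close>: eigenpairs whose vector is orthogonal
    to the first \<open>q\<close> vectors of \<open>g\<close>.\<close>
  define eigs where "eigs = (\<lambda>(q :: nat) (g :: nat \<Rightarrow> complex vec). {(v, c). v \<in> carrier_vec D \<and> v \<noteq> 0\<^sub>v D \<and>
      B *\<^sub>v v = c \<cdot>\<^sub>v v \<and> (\<forall>l<q. v \<bullet>c g l = 0)})"
  have "\<exists>g \<mu>. orthonormal_family D q g \<and> (\<forall>i<p. g i = e i \<and> \<mu> i = \<nu> i) \<and>
      (\<forall>i<q. B *\<^sub>v g i = of_real (\<mu> i) \<cdot>\<^sub>v g i) \<and>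
      (\<forall>i\<in>{p..<q}. \<forall>(v, c)\<in>eigs i g. Re c \<le> \<mu> i)" if "p \<le> q" "q \<le> D" for q
    using that
  proof (induction q rule: dec_induct)
    case base
    show ?case using e eig by (intro exI[of _ e] exI[of _ \<nu>]) auto
  next
    case (step q)
    then obtain g \<mu> where g: "orthonormal_family D q g" "\<forall>i<p. g i = e i \<and> \<mu> i = \<nu> i"
      "\<forall>i<q. B *\<^sub>v g i = of_real (\<mu> i) \<cdot>\<^sub>v g i"
      "\<forall>i\<in>{p..<q}. \<forall>(v, c)\<in>eigs i g. Re c \<le> \<mu> i"
      by auto
    \<comment> \<open>A maximum exists: candidate eigenvalues lie in the finite spectrum of
      \<open>B\<close>, and an orthogonal eigenvector exists as long as
      \<open>q < D\<close>.\<close>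
    define S where "S = (\<lambda>(v, c). Re c) ` eigs q g"
    have "S \<subseteq> Re ` spectrum B"
      using B by (fastforce simp: S_def eigs_def spectrum_def eigenvalue_def eigenvector_def)
    then have "finite S" using card_finite_spectrum(1)[OF B(2)] finite_surj by blast
    moreover have "S \<noteq> {}"
    proof -
      obtain v c where "v \<in> carrier_vec D" "v \<noteq> 0\<^sub>v D" "B *\<^sub>v v = c \<cdot>\<^sub>v v"
        "\<And>i. i < q \<Longrightarrow> v \<bullet>c g i = 0"
        using exists_orthogonal_eigenvector[OF B g(1), of "\<lambda>i. of_real (\<mu> i)"] step g(3) by auto
      then have "(v, c) \<in> eigs q g" by (auto simp: eigs_def)
      then show ?thesis by (auto simp: S_def)
    qed
    ultimately have "Max S \<in> S" and max: "\<And>s. s \<in> S \<Longrightarrow> s \<le> Max S" by auto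
    then obtain v c where vc: "(v, c) \<in> eigs q g" "Re c = Max S" by (auto simp: S_def)
    then have v: "v \<in> carrier_vec D" "v \<noteq> 0\<^sub>v D" "B *\<^sub>v v = c \<cdot>\<^sub>v v"
      "\<And>l. l < q \<Longrightarrow> v \<bullet>c g l = 0" by (auto simp: eigs_def)
    obtain t where t: "(t \<cdot>\<^sub>v v) \<bullet>c (t \<cdot>\<^sub>v v) = 1" using exists_unit_multiple v(1,2) by blast
    define w where "w = t \<cdot>\<^sub>v v"
    have "c = of_real (Re c)" by (rule self_adjoint_eigenvalue_real[OF B v(1-3)])
    then have w: "w \<in> carrier_vec D" "B *\<^sub>v w = of_real (Max S) \<cdot>\<^sub>v w"
      using v vc B by (auto simp: w_def mult_mat_vec[of _ D D] smult_smult_assoc mult.commute)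
    have "orthonormal_family D (Suc q) (g(q := w))"
      using v t g w unfolding w_def
      by (intro orthonormal_family_Suc) (auto simp: orthonormal_family_def)
    moreover have "\<forall>i<p. (g(q := w)) i = e i \<and> (\<mu>(q := Max S)) i = \<nu> i"
      using g(2) step by auto
    moreover have "\<forall>i<Suc q. B *\<^sub>v (g(q := w)) i = of_real ((\<mu>(q := Max S)) i) \<cdot>\<^sub>v (g(q := w)) i"
      using g(3) w by (auto simp: less_Suc_eq)
    moreover have "\<forall>i\<in>{p..<Suc q}. \<forall>(v, c)\<in>eigs i (g(q := w)). Re c \<le> (\<mu>(q := Max S)) i"
    proof -
      \<comment> \<open>Stage \<open>i\<close> inspects only vectors with index below
        \<open>i \<le> q\<close>, so changing \<open>g\<close> at \<open>q\<close> leaves the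
        earlier maxima valid.\<close>
      have "eigs i (g(q := w)) = eigs i g" if "i \<le> q" for i
        using that by (auto simp: eigs_def)
      moreover have "Re c \<le> Max S" if "(v, c) \<in> eigs q g" for v c
        using max that unfolding S_def by force
      moreover have "Re c \<le> \<mu> i" if "(v, c) \<in> eigs i g" "p \<le> i" "i < q" for i v c
        using g(4) that by fastforce
      ultimately show ?thesis by (auto simp: less_Suc_eq)
    qed
    ultimately show ?case by blast
  qed
  from this[OF e(2) order_refl] obtain g \<mu> where g: "orthonormal_family D D g"
    "\<forall>i<p. g i = e i \<and> \<mu> i = \<nu> i" "\<forall>i<D. B *\<^sub>v g i = of_real (\<mu> i) \<cdot>\<^sub>v g i"
    "\<forall>i\<in>{p..<D}. \<forall>(v, c)\<in>eigs i g. Re c \<le> \<mu> i" by blast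
  have "\<mu> l \<le> \<mu> i" if "p \<le> i" "i \<le> l" "l < D" for i l
  proof -
    have "g l \<bullet>c g l = 1" using g(1) that by (auto simp: orthonormal_family_def)
    then have "g l \<noteq> 0\<^sub>v D" by auto
    \<comment> \<open>The later vector \<open>g l\<close> is orthogonal to all vectors before
      \<open>g i\<close>, so it was already a candidate when \<open>g i\<close> was chosen.\<close>
    then have "(g l, of_real (\<mu> l)) \<in> eigs i g"
      using g(1,3) that by (auto simp: eigs_def orthonormal_family_def)
    then show ?thesis using g(4) that by fastforce
  qed
  with g that show ?thesis by blast
qed

lemma sorted_eigenbasis:
  fixes B :: "complex mat"
  assumes "mat_adjoint B = B" "B \<in> carrier_mat D D"
  obtains g and \<mu> :: "nat \<Rightarrow> real" where "orthonormal_family D D g"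
    "\<And>i. i < D \<Longrightarrow> B *\<^sub>v g i = of_real (\<mu> i) \<cdot>\<^sub>v g i"
    "\<And>i l. i \<le> l \<Longrightarrow> l < D \<Longrightarrow> \<mu> l \<le> \<mu> i"
proof (rule sorted_eigenbasis_extension[OF assms, of 0 "\<lambda>_. 0\<^sub>v D" "\<lambda>_. 0"])
  show "orthonormal_family D 0 (\<lambda>_. 0\<^sub>v D)" by (simp add: orthonormal_family_def)
next
  fix g and \<mu> :: "nat \<Rightarrow> real"
  assume "orthonormal_family D D g" "\<And>i. i < D \<Longrightarrow> B *\<^sub>v g i = of_real (\<mu> i) \<cdot>\<^sub>v g i"
    "\<And>i l. 0 \<le> i \<Longrightarrow> i \<le> l \<Longrightarrow> l < D \<Longrightarrow> \<mu> l \<le> \<mu> i"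
  then show thesis using that[of g \<mu>] by simp
qed auto

section \<open>Spectral decomposition, positivity and singular values\<close>

text \<open>The spectral decomposition read entrywise: it results from applying \<open>B\<close> to
  the completeness relation of \<open>e\<close>.\<close>

lemma eigenbasis_entry:
  assumes e: "orthonormal_family D D e" and B: "B \<in> carrier_mat D D"
    and eig: "\<And>i. i < D \<Longrightarrow> B *\<^sub>v e i = c i \<cdot>\<^sub>v e i" and ab: "a < D" "b < D"
  shows "B $$ (a, b) = (\<Sum>i<D. c i * e i $ a * cnj (e i $ b))"
proof -
  have ec: "e i \<in> carrier_vec D" if "i < D" for i using e that by (auto simp: orthonormal_family_def)
  have "(\<Sum>i<D. c i * e i $ a * cnj (e i $ b)) = (\<Sum>i<D. (B *\<^sub>v e i) $ a * cnj (e i $ b))"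
    using eig carrier_vecD[OF ec] ab by (intro sum.cong) auto
  also have "\<dots> = (\<Sum>i<D. \<Sum>k<D. B $$ (a, k) * (e i $ k * cnj (e i $ b)))"
    using mult_mat_vec_sum[OF B ec ab(1)]
    by (intro sum.cong) (auto simp: sum_distrib_left mult_ac simp del: index_mult_mat_vec)
  also have "\<dots> = (\<Sum>k<D. B $$ (a, k) * (\<Sum>i<D. e i $ k * cnj (e i $ b)))"
    by (subst sum.swap) (simp add: sum_distrib_left)
  also have "\<dots> = (\<Sum>k<D. if k = b then B $$ (a, k) else 0)"
    using orthonormal_family_complete[OF e _ ab(2)] by (intro sum.cong) auto
  also have "\<dots> = B $$ (a, b)" using ab by simp
  finally show ?thesis by simp
qed

text \<open>By the spectral decomposition the quadratic form at \<open>v\<close> is the sum of the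
  \<open>\<mu> i\<close> times the squared modulus of \<open>v \<bullet>c e i\<close>.
  Self-adjointness holds because the \<open>\<mu> i\<close> are real.\<close>

lemma eigenbasis_positive_op:
  assumes e: "orthonormal_family D D e" and B: "B \<in> carrier_mat D D"
    and eig: "\<And>i. i < D \<Longrightarrow> B *\<^sub>v e i = of_real (\<mu> i) \<cdot>\<^sub>v e i"
    and nonneg: "\<And>i. i < D \<Longrightarrow> 0 \<le> \<mu> i"
  shows "positive_op D B"
proof -
  note entry = eigenbasis_entry[OF e B eig]
  have ec: "e i \<in> carrier_vec D" if "i < D" for i using e that by (auto simp: orthonormal_family_def)
  have "mat_adjoint B = B"
    by (rule self_adjointI[OF B]) (simp add: entry mult_ac)
  moreover have "0 \<le> Re ((B *\<^sub>v v) \<bullet>c v)" if v: "v \<in> carrier_vec D" for v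
  proof -
    have "(B *\<^sub>v v) \<bullet>c v
        = (\<Sum>a<D. \<Sum>b<D. \<Sum>i<D. of_real (\<mu> i) * (v $ b * cnj (e i $ b)) * (e i $ a * cnj (v $ a)))"
      unfolding cscalar_prod_sum[OF v]
      by (intro sum.cong refl, subst mult_mat_vec_sum[OF B v])
        (auto simp: entry sum_distrib_left sum_distrib_right mult_ac)
    also have "\<dots> = (\<Sum>a<D. \<Sum>i<D. \<Sum>b<D. of_real (\<mu> i) * (v $ b * cnj (e i $ b)) * (e i $ a * cnj (v $ a)))"
      by (rule sum.cong[OF refl], rule sum.swap)
    also have "\<dots> = (\<Sum>i<D. \<Sum>a<D. \<Sum>b<D. of_real (\<mu> i) * (v $ b * cnj (e i $ b)) * (e i $ a * cnj (v $ a)))"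
      by (rule sum.swap)
    also have "\<dots> = (\<Sum>i<D. of_real (\<mu> i) * ((v \<bullet>c e i) * (e i \<bullet>c v)))"
      using ec by (intro sum.cong refl)
        (simp add: cscalar_prod_sum[OF v] cscalar_prod_sum[OF ec] sum_distrib_left sum_distrib_right mult_ac)
    also have "\<dots> = (\<Sum>i<D. of_real (\<mu> i * (cmod (v \<bullet>c e i))\<^sup>2))"
      using ec v cscalar_prod_swap[of "e _" D v]
      by (intro sum.cong refl) (simp add: complex_norm_square del: of_real_power)
    finally have "Re ((B *\<^sub>v v) \<bullet>c v) = (\<Sum>i<D. \<mu> i * (cmod (v \<bullet>c e i))\<^sup>2)"
      by simp
    then show ?thesis using nonneg by (auto intro!: sum_nonneg mult_nonneg_nonneg)
  qed
  ultimately show ?thesis using B by (simp add: positive_op_def)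
qed

text \<open>Since \<open>B\<close> is self-adjoint, the product in \<open>singular_values\<close> is
  \<open>B * B\<close>, which the unitary \<open>E\<close> with columns \<open>e i\<close>
  diagonalizes with diagonal entries the squares of the \<open>\<mu> i\<close>. Nonnegativity lets
  the square root recover \<open>\<mu> i\<close>, and the decreasing order makes the sorted list
  agree with the indexing by \<open>i\<close>.\<close>

lemma singular_values_eigenbasis:
  assumes e: "orthonormal_family D D e" and B: "B \<in> carrier_mat D D"
    and eig: "\<And>i. i < D \<Longrightarrow> B *\<^sub>v e i = of_real (\<mu> i) \<cdot>\<^sub>v e i"
    and nonneg: "\<And>i. i < D \<Longrightarrow> 0 \<le> \<mu> i"
    and decr: "\<And>i l. i \<le> l \<Longrightarrow> l < D \<Longrightarrow> \<mu> l \<le> \<mu> i"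
  shows "singular_values B = map \<mu> [0..<D]"
proof -
  have ec: "e i \<in> carrier_vec D" if "i < D" for i using e that by (auto simp: orthonormal_family_def)
  have BB: "mat_adjoint B * B = B * B"
    using eigenbasis_positive_op[OF e B eig nonneg] by (simp add: positive_op_def)
  have eig2: "(B * B) *\<^sub>v e i = of_real ((\<mu> i)\<^sup>2) \<cdot>\<^sub>v e i" if "i < D" for i
    using that ec[OF that] B
    by (simp add: assoc_mult_mat_vec[of _ D D _ D] eig mult_mat_vec[of _ D D] smult_smult_assoc power2_eq_square)
  define E where "E = mat D D (\<lambda>(a, i). e i $ a)"
  define F where "F = mat D D (\<lambda>(i, a). cnj (e i $ a))"
  define \<Delta> :: "complex mat" where "\<Delta> = mat_diag D (\<lambda>i. of_real ((\<mu> i)\<^sup>2))"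
  have carr: "E \<in> carrier_mat D D" "F \<in> carrier_mat D D" "\<Delta> \<in> carrier_mat D D"
    by (auto simp: E_def F_def \<Delta>_def)
  have EF: "E * F = 1\<^sub>m D"
    using orthonormal_family_complete[OF e]
    by (intro eq_matI) (auto simp: E_def F_def scalar_prod_def atLeast0LessThan)
  have "B * B = E * \<Delta> * F"
  proof (rule eq_matI)
    fix a b assume ab: "a < dim_row (E * \<Delta> * F)" "b < dim_col (E * \<Delta> * F)"
    then have "(B * B) $$ (a, b) = (\<Sum>i<D. of_real ((\<mu> i)\<^sup>2) * e i $ a * cnj (e i $ b))"
      using carr B by (intro eigenbasis_entry[OF e _ eig2]) auto
    then show "(B * B) $$ (a, b) = (E * \<Delta> * F) $$ (a, b)"
      using ab carr unfolding \<Delta>_def mat_diag_mult_right[OF carr(1)]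
      by (auto simp: E_def F_def scalar_prod_def atLeast0LessThan mult_ac intro!: sum.cong)
  qed (use carr B in auto)
  then have "similar_mat (B * B) \<Delta>"
    unfolding similar_mat_def
    using carr B EF mat_mult_left_right_inverse[OF carr(1,2) EF]
    by (intro exI[of _ E] exI[of _ F] similar_mat_witI[of _ _ D]) auto
  then have "char_poly (mat_adjoint B * B) = char_poly \<Delta>"
    unfolding BB by (rule char_poly_similar)
  also have "\<dots> = (\<Prod>a\<leftarrow>diag_mat \<Delta>. [:- a, 1:])"
    by (rule char_poly_upper_triangular[OF carr(3)]) (auto simp: \<Delta>_def mat_diag_def upper_triangular_def)
  also have "diag_mat \<Delta> = map (\<lambda>i. of_real ((\<mu> i)\<^sup>2)) [0..<D]"
    by (auto simp: diag_mat_def \<Delta>_def mat_diag_def)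
  also have "proots (\<Prod>a\<leftarrow>map (\<lambda>i. of_real ((\<mu> i)\<^sup>2)) [0..<D]. [:- a, 1:])
      = mset (map (\<lambda>i. of_real ((\<mu> i)\<^sup>2)) [0..<D] :: complex list)"
  proof -
    \<comment> \<open>Roots are collected with multiplicity, one for each linear factor.\<close>
    have "proots (\<Prod>a\<leftarrow>as. [:- a, 1:]) = mset as" for as :: "complex list"
    proof (induction as)
      case (Cons a as)
      have "(\<Prod>a\<leftarrow>as. [:- a, 1:]) \<noteq> 0" by (auto simp: prod_list_zero_iff)
      then have "proots ([:- a, 1:] * (\<Prod>a\<leftarrow>as. [:- a, 1:])) = {#a#} + mset as"
        using Cons by (subst proots_mult) auto
      then show ?case by simp
    qed simp
    then show ?thesis .
  qed
  finally have roots: "proots (char_poly (mat_adjoint B * B)) = \<dots>" .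
  have "image_mset (\<lambda>z. sqrt (Re z)) (proots (char_poly (mat_adjoint B * B)))
      = mset (map (\<lambda>i. sqrt ((\<mu> i)\<^sup>2)) [0..<D])"
    unfolding roots by (simp add: comp_def image_mset.compositionality)
  also have "map (\<lambda>i. sqrt ((\<mu> i)\<^sup>2)) [0..<D] = map \<mu> [0..<D]"
    using nonneg by simp
  \<comment> \<open>The reversed list is already ascending, so sorting leaves it alone and the outer
    \<open>rev\<close> restores the original list.\<close>
  also have "mset (map \<mu> [0..<D]) = mset (rev (map \<mu> [0..<D]))" by simp
  finally have "singular_values B = rev (sort (rev (map \<mu> [0..<D])))"
    unfolding singular_values_def by (simp only: sorted_list_of_multiset_mset)
  moreover have "sorted (rev (map \<mu> [0..<D]))"
    using decr by (auto simp: sorted_iff_nth_mono rev_nth)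
  ultimately show ?thesis by (simp only: sorted_sort_id rev_rev_ident)
qed

text \<open>The inner product with \<open>e l\<close> isolates the coefficient of \<open>e l\<close>
  in a vanishing combination, so the family is independent; \<open>D\<close> independent vectors in
  dimension \<open>D\<close> form a basis.\<close>

lemma orthonormal_family_basis:
  assumes "orthonormal_family D D e"
  shows "orthonormal_basis D e"
proof -
  interpret vec_space "TYPE(complex)" D .
  have ec: "e i \<in> carrier_vec D" if "i < D" for i using assms that by (auto simp: orthonormal_family_def)
  have eo: "e i \<bullet>c e l = (if i = l then 1 else 0)" if "i < D" "l < D" for i l
    using assms that by (auto simp: orthonormal_family_def)
  \<comment> \<open>Injectivity ensures that the image set really has \<open>D\<close> elements and
    that sums over it can be indexed by \<open>i < D\<close>.\<close>
  have inj: "inj_on e {..<D}"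
    using eo by (intro inj_onI) (metis lessThan_iff zero_neq_one)
  have S: "e ` {..<D} \<subseteq> carrier_vec D" using ec by auto
  have "lin_indpt (e ` {..<D})"
  proof (rule finite_lin_indpt2)
    fix a :: "complex vec \<Rightarrow> complex" assume 0: "lincomb a (e ` {..<D}) = 0\<^sub>v D"
    show "\<forall>v\<in>e ` {..<D}. a v = 0"
    proof
      fix v assume "v \<in> e ` {..<D}"
      then obtain l where l: "l < D" "v = e l" by auto
      have comb: "(\<Sum>i<D. a (e i) * e i $ b) = 0" if "b < D" for b
        using lincomb_index[OF that S, of a] 0 that by (simp add: sum.reindex[OF inj])
      have "(\<Sum>b<D. (\<Sum>i<D. a (e i) * e i $ b) * cnj (e l $ b)) = (\<Sum>i<D. a (e i) * (e i \<bullet>c e l))"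
        unfolding cscalar_prod_sum[OF ec[OF l(1)]] sum_distrib_right sum_distrib_left
        by (subst sum.swap) (simp add: mult.assoc)
      also have "\<dots> = (\<Sum>i<D. if i = l then a (e i) else 0)"
        using eo l by (intro sum.cong) auto
      finally show "a v = 0" using l comb by simp
    qed
  qed (use S in auto)
  then have "basis (e ` {..<D})"
    using S by (intro dim_li_is_basis fin_dim) (auto simp: dim_is_n card_image[OF inj])
  then show ?thesis using ec eo by (auto simp: orthonormal_basis_def)
qed

lemma finsum_mat_carrier:
  fixes f :: "'i \<Rightarrow> 'a :: comm_ring_1 mat"
  assumes "\<And>i. i \<in> S \<Longrightarrow> f i \<in> carrier_mat nr nc"
  shows "finsum (module_mat TYPE('a) nr nc) f S \<in> carrier_mat nr nc"
proof -
  interpret abelian_group "module_mat TYPE('a) nr nc" by (rule abelian_group_mat)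
  show ?thesis using finsum_closed[of f S] assms by (auto simp: module_mat_simps)
qed

text \<open>The sum in \<open>monotone_family\<close> is formed in the additive group of the matrix
  module; this reduces it to ordinary sums of entries.\<close>

lemma finsum_mat_index:
  fixes f :: "'i \<Rightarrow> 'a :: comm_ring_1 mat"
  assumes "finite S" "\<And>i. i \<in> S \<Longrightarrow> f i \<in> carrier_mat nr nc" "a < nr" "b < nc"
  shows "finsum (module_mat TYPE('a) nr nc) f S $$ (a, b) = (\<Sum>i\<in>S. f i $$ (a, b))"
proof -
  interpret abelian_group "module_mat TYPE('a) nr nc" by (rule abelian_group_mat)
  show ?thesis using assms(1,2)
  proof (induction S rule: finite_induct)
    case empty
    then show ?case using assms(3,4) by (simp add: module_mat_simps)
  next
    case (insert x S)
    then have "finsum (module_mat TYPE('a) nr nc) f (insert x S)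
        = f x + finsum (module_mat TYPE('a) nr nc) f S"
      by (subst finsum_insert) (auto simp: module_mat_simps)
    then show ?case
      using insert assms(3,4) finsum_mat_carrier[of S f nr nc]
      by (simp add: carrier_matD[OF finsum_mat_carrier[of S f nr nc]])
  qed
qed

text \<open>Decreasing nonnegative eigenvalues along \<open>e\<close> are the singular values in
  their order, so the required sum of projections is the spectral decomposition.\<close>

lemma monotone_familyI:
  assumes e: "orthonormal_family D D e" and B: "\<And>j. j \<le> n \<Longrightarrow> B j \<in> carrier_mat D D"
    and eig: "\<And>j i. j \<le> n \<Longrightarrow> i < D \<Longrightarrow> B j *\<^sub>v e i = of_real (\<mu> j i) \<cdot>\<^sub>v e i"
    and nonneg: "\<And>j i. j \<le> n \<Longrightarrow> i < D \<Longrightarrow> 0 \<le> \<mu> j i"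
    and decr: "\<And>j i l. j \<le> n \<Longrightarrow> i \<le> l \<Longrightarrow> l < D \<Longrightarrow> \<mu> j l \<le> \<mu> j i"
  shows "monotone_family D n B"
proof -
  have ec: "dim_vec (e i) = D" if "i < D" for i using e that by (auto simp: orthonormal_family_def)
  have "B j = finsum (module_mat TYPE(complex) D D)
      (\<lambda>i. complex_of_real (singular_values (B j) ! i) \<cdot>\<^sub>m rank_one_proj (e i)) {..<D}"
    (is "_ = finsum ?M ?f _") if j: "j \<le> n" for j
  proof -
    have f: "?f i \<in> carrier_mat D D" if "i \<in> {..<D}" for i
      using that by (auto simp: rank_one_proj_def ec)
    note sv = singular_values_eigenbasis[OF e B[OF j] eig[OF j] nonneg[OF j] decr[OF j]]
    show ?thesis
    proof (rule eq_matI)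
      fix a b assume "a < dim_row (finsum ?M ?f {..<D})" "b < dim_col (finsum ?M ?f {..<D})"
      then have ab: "a < D" "b < D" using finsum_mat_carrier[of "{..<D}" ?f D D, OF f] by auto
      then have "finsum ?M ?f {..<D} $$ (a, b) = (\<Sum>i<D. ?f i $$ (a, b))"
        using finsum_mat_index[of "{..<D}" ?f D D, OF _ f] by simp
      also have "\<dots> = (\<Sum>i<D. of_real (\<mu> j i) * e i $ a * cnj (e i $ b))"
        using ab by (intro sum.cong) (auto simp: rank_one_proj_def ec sv)
      also have "\<dots> = B j $$ (a, b)" using eigenbasis_entry[OF e B[OF j] eig[OF j] ab] by simp
      finally show "B j $$ (a, b) = finsum ?M ?f {..<D} $$ (a, b)" by simp
    qed (use finsum_mat_carrier[of "{..<D}" ?f D D, OF f] B[OF j] in auto)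
  qed
  then show ?thesis
    using eigenbasis_positive_op[OF e B eig nonneg] orthonormal_family_basis[OF e]
    unfolding monotone_family_def by blast
qed

subsection \<open>The operators \<open>A(m)\<close>, \<open>A[m]\<close> and \<open>A\<langle>m\<rangle>\<close>\<close>

text \<open>The form of monotonicity on which the induction runs: the eigenvalues are explicit
  functions \<open>\<mu> j\<close>, so \<open>singular_values\<close> enters only when the final
  family is translated back.\<close>

definition common_eigenbasis :: "nat \<Rightarrow> nat \<Rightarrow> (nat \<Rightarrow> complex mat) \<Rightarrow> bool" where
  "common_eigenbasis D n X \<longleftrightarrow> (\<forall>j\<le>n. X j \<in> carrier_mat D D) \<and>
     (\<exists>e \<mu>. orthonormal_family D D e \<and>
        (\<forall>j\<le>n. (\<forall>i<D. X j *\<^sub>v e i = of_real (\<mu> j i) \<cdot>\<^sub>v e i \<and> 0 \<le> (\<mu> j i :: real)) \<and>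
           (\<forall>i l. i \<le> l \<longrightarrow> l < D \<longrightarrow> \<mu> j l \<le> \<mu> j i)))"

lemma common_eigenbasis_imp_monotone_family:
  assumes "common_eigenbasis D n X"
  shows "monotone_family D n X"
proof -
  obtain e \<mu> where e: "orthonormal_family D D e" and
    \<mu>: "\<forall>j\<le>n. (\<forall>i<D. X j *\<^sub>v e i = of_real (\<mu> j i) \<cdot>\<^sub>v e i \<and> 0 \<le> (\<mu> j i :: real)) \<and>
           (\<forall>i l. i \<le> l \<longrightarrow> l < D \<longrightarrow> \<mu> j l \<le> \<mu> j i)"
    using assms unfolding common_eigenbasis_def by (elim conjE exE) (rule that)
  show ?thesis
  proof (rule monotone_familyI[OF e])
    show "X j \<in> carrier_mat D D" if "j \<le> n" for j
      using assms that unfolding common_eigenbasis_def by blast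
    show "X j *\<^sub>v e i = of_real (\<mu> j i) \<cdot>\<^sub>v e i" "0 \<le> \<mu> j i" if "j \<le> n" "i < D" for j i
      using \<mu> that by blast+
    show "\<mu> j l \<le> \<mu> j i" if "j \<le> n" "i \<le> l" "l < D" for j i l
      using \<mu> that by blast
  qed
qed

lemma common_eigenbasis_cong:
  assumes "common_eigenbasis D n X" "\<And>j. j \<le> n \<Longrightarrow> X j = Y j"
  shows "common_eigenbasis D n Y"
  using assms unfolding common_eigenbasis_def by simp

text \<open>\<open>repeat_vec D m v\<close> is \<open>v \<otimes> (1, \<dots>, 1)\<close>, and \<open>block_sum\<close> is the adjoint of \<open>repeat_vec\<close>.\<close>

definition block :: "nat \<Rightarrow> complex vec \<Rightarrow> nat \<Rightarrow> complex vec" where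
  "block D f b = vec D (\<lambda>a. f $ (b * D + a))"

definition block_sum :: "nat \<Rightarrow> nat \<Rightarrow> complex vec \<Rightarrow> complex vec" where
  "block_sum D m f = vec D (\<lambda>a. \<Sum>b<m. f $ (b * D + a))"

definition repeat_vec :: "nat \<Rightarrow> nat \<Rightarrow> complex vec \<Rightarrow> complex vec" where
  "repeat_vec D m v = vec (m * D) (\<lambda>i. v $ (i mod D))"

lemma block_index_less: "b < m \<Longrightarrow> a < D \<Longrightarrow> b * D + a < m * (D :: nat)"
  using mult_le_mono1[of "Suc b" m D] by simp

lemma sum_blocks: "(\<Sum>r<m * D. h r) = (\<Sum>b<m. \<Sum>a<D. h (b * D + a))"
  for h :: "nat \<Rightarrow> 'a :: comm_monoid_add"
proof -
  have "(\<Sum>r<m * D. h r) = (\<Sum>b<m. sum h {b * D..<b * D + D})"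
    by (rule sum.nat_group[symmetric])
  moreover have "sum h {b * D..<b * D + D} = (\<Sum>a<D. h (b * D + a))" for b
    using sum.shift_bounds_nat_ivl[of h 0 "b * D" D] by (simp add: add.commute lessThan_atLeast0)
  ultimately show ?thesis by simp
qed

lemma block_carrier [simp]: "block D f b \<in> carrier_vec D"
  and block_sum_carrier [simp]: "block_sum D m f \<in> carrier_vec D"
  and repeat_vec_carrier [simp]: "repeat_vec D m v \<in> carrier_vec (m * D)"
  by (simp_all add: block_def block_sum_def repeat_vec_def)

lemma block_repeat_vec:
  assumes "v \<in> carrier_vec D" "b < m"
  shows "block D (repeat_vec D m v) b = v"
  using assms by (intro eq_vecI) (auto simp: block_def repeat_vec_def block_index_less)

lemma block_eqI:
  assumes "f \<in> carrier_vec (m * D)" "g \<in> carrier_vec (m * D)"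
    and "\<And>b. b < m \<Longrightarrow> block D f b = block D g b"
  shows "f = g"
proof (rule eq_vecI)
  fix r assume "r < dim_vec g"
  then have r: "r < m * D" using assms by simp
  then have *: "r div D < m" "r mod D < D"
    by (auto simp: less_mult_imp_div_less intro!: mod_less_divisor intro: gr0I)
  have "block D f (r div D) $ (r mod D) = block D g (r div D) $ (r mod D)"
    using assms(3)[OF *(1)] by simp
  then show "f $ r = g $ r" using * by (simp add: block_def)
qed (use assms in auto)

lemma block_smult:
  "f \<in> carrier_vec (m * D) \<Longrightarrow> b < m \<Longrightarrow> block D (c \<cdot>\<^sub>v f) b = c \<cdot>\<^sub>v block D f b"
  by (intro eq_vecI) (auto simp: block_def block_index_less)

text \<open>Used to see that a vector orthogonal to all \<open>repeat_vec D m (e l)\<close>, for an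
  orthonormal basis \<open>e\<close>, has zero block sum.\<close>

lemma cscalar_prod_repeat_vec:
  assumes "v \<in> carrier_vec D" "f \<in> carrier_vec (m * D)"
  shows "f \<bullet>c repeat_vec D m v = block_sum D m f \<bullet>c v"
proof -
  have "f \<bullet>c repeat_vec D m v = (\<Sum>b<m. \<Sum>a<D. f $ (b * D + a) * cnj (v $ a))"
    unfolding cscalar_prod_sum[OF repeat_vec_carrier] sum_blocks
    by (intro sum.cong) (auto simp: repeat_vec_def block_index_less)
  also have "\<dots> = (\<Sum>a<D. (\<Sum>b<m. f $ (b * D + a)) * cnj (v $ a))"
    by (subst sum.swap) (simp add: sum_distrib_right)
  also have "\<dots> = block_sum D m f \<bullet>c v"
    using assms by (simp add: cscalar_prod_sum[OF assms(1)] block_sum_def)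
  finally show ?thesis .
qed

lemma block_sum_repeat_vec:
  assumes "v \<in> carrier_vec D"
  shows "block_sum D m (repeat_vec D m v) = of_nat m \<cdot>\<^sub>v v"
  using assms by (intro eq_vecI) (auto simp: block_sum_def repeat_vec_def block_index_less)

lemma sum_mult_mat_vec_block:
  assumes "X \<in> carrier_mat D D" "a < D"
  shows "(\<Sum>c<m. (X *\<^sub>v block D f c) $ a) = (X *\<^sub>v block_sum D m f) $ a"
proof -
  have "(\<Sum>c<m. (X *\<^sub>v block D f c) $ a) = (\<Sum>c<m. \<Sum>b<D. X $$ (a, b) * f $ (c * D + b))"
    by (intro sum.cong refl, subst mult_mat_vec_sum[OF assms(1) block_carrier assms(2)])
      (auto simp: block_def)
  also have "\<dots> = (\<Sum>b<D. X $$ (a, b) * (\<Sum>c<m. f $ (c * D + b)))"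
    by (subst sum.swap) (simp add: sum_distrib_left)
  also have "\<dots> = (X *\<^sub>v block_sum D m f) $ a"
    by (subst mult_mat_vec_sum[OF assms(1) block_sum_carrier assms(2)]) (auto simp: block_sum_def)
  finally show ?thesis .
qed

section \<open>Block matrices and their action on vectors\<close>

lemma block_matrix_carrier [simp]: "block_matrix m D F \<in> carrier_mat (m * D) (m * D)"
  by (simp add: block_matrix_def)

lemma block_matrix_entry:
  assumes "b < m" "c < m" "a < D" "a' < D"
  shows "block_matrix m D F $$ (b * D + a, c * D + a') = F b c $$ (a, a')"
  using assms by (simp add: block_matrix_def block_index_less)

lemma block_matrix_mult_vec:
  assumes "\<And>b c. b < m \<Longrightarrow> c < m \<Longrightarrow> F b c \<in> carrier_mat D D"
    and f: "f \<in> carrier_vec (m * D)" and b: "b < m" and a: "a < D"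
  shows "block D (block_matrix m D F *\<^sub>v f) b $ a = (\<Sum>c<m. (F b c *\<^sub>v block D f c) $ a)"
proof -
  have "block D (block_matrix m D F *\<^sub>v f) b $ a
      = (\<Sum>c<m. \<Sum>a'<D. block_matrix m D F $$ (b * D + a, c * D + a') * f $ (c * D + a'))"
    using a mult_mat_vec_sum[OF block_matrix_carrier[of m D F] f block_index_less[OF b a]]
    by (simp add: block_def sum_blocks del: index_mult_mat_vec)
  also have "\<dots> = (\<Sum>c<m. (F b c *\<^sub>v block D f c) $ a)"
  proof (rule sum.cong)
    fix c assume "c \<in> {..<m}"
    then show "(\<Sum>a'<D. block_matrix m D F $$ (b * D + a, c * D + a') * f $ (c * D + a'))
        = (F b c *\<^sub>v block D f c) $ a"
      using assms by (subst mult_mat_vec_sum[of "F b c" D D]) (auto simp: block_matrix_entry block_def)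
  qed simp
  finally show ?thesis .
qed

lemma block_matrix_self_adjoint:
  assumes "\<And>b c a a'. b < m \<Longrightarrow> c < m \<Longrightarrow> a < D \<Longrightarrow> a' < D \<Longrightarrow>
      F b c $$ (a, a') = cnj (F c b $$ (a', a))"
  shows "mat_adjoint (block_matrix m D F) = block_matrix m D F"
proof (rule self_adjointI[OF block_matrix_carrier])
  fix r s assume rs: "r < m * D" "s < m * D"
  then have "D > 0" by (auto intro: gr0I)
  then show "block_matrix m D F $$ (r, s) = cnj (block_matrix m D F $$ (s, r))"
    using rs assms[of "r div D" "s div D" "r mod D" "s mod D"]
    by (simp add: block_matrix_def less_mult_imp_div_less)
qed

lemma amp_square_carrier: "X \<in> carrier_mat D D \<Longrightarrow> amp_square X m \<in> carrier_mat (m * D) (m * D)"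
  and amp_round_carrier: "X \<in> carrier_mat D D \<Longrightarrow> amp_round X m \<in> carrier_mat (m * D) (m * D)"
  and amp_angle_carrier: "X \<in> carrier_mat D D \<Longrightarrow> amp_angle X m \<in> carrier_mat (m * D) (m * D)"
  by (auto simp: amp_square_def amp_round_def amp_angle_def)

lemma amp_square_1: "X \<in> carrier_mat D D \<Longrightarrow> amp_square X 1 = X"
  by (intro eq_matI) (auto simp: amp_square_def block_matrix_def)

lemma amp_round_1: "X \<in> carrier_mat D D \<Longrightarrow> amp_round X 1 = X"
  by (intro eq_matI) (auto simp: amp_round_def block_matrix_def)

text \<open>An entry of \<open>amp_square\<close> depends only on its indices modulo the block size,
  and reducing modulo \<open>p * D\<close> and then modulo \<open>D\<close> is reducing modulo
  \<open>D\<close>. In the induction this absorbs each new factor into \<open>k''\<close>.\<close>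

lemma amp_square_amp_square:
  assumes "X \<in> carrier_mat D D"
  shows "amp_square (amp_square X p) q = amp_square X (q * p)"
proof -
  have "amp_square X p \<in> carrier_mat (p * D) (p * D)" using assms by (rule amp_square_carrier)
  then have dims: "dim_row X = D" "dim_row (amp_square X p) = p * D" using assms by auto
  show ?thesis
  proof (rule eq_matI)
    fix r s assume "r < dim_row (amp_square X (q * p))" "s < dim_col (amp_square X (q * p))"
    then have rs: "r < q * (p * D)" "s < q * (p * D)"
      using amp_square_carrier[OF assms, of "q * p"] by (auto simp: mult.assoc)
    then have "p * D > 0" by (auto intro: gr0I)
    then show "amp_square (amp_square X p) q $$ (r, s) = amp_square X (q * p) $$ (r, s)"
      using rs unfolding amp_square_def[of "amp_square X p" q] dims block_matrix_def
      by (simp add: amp_square_def dims block_matrix_def mod_mod_cancel mult.assoc)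
  qed (use amp_square_carrier[OF assms, of "q * p"]
      amp_square_carrier[OF amp_square_carrier[OF assms, of p], of q] in \<open>auto simp: mult.assoc\<close>)
qed

text \<open>All block rows are equal, and each applies \<open>X\<close> to the sum of the blocks of
  \<open>f\<close>. Thus the operator is \<open>X\<close> sandwiched between
  \<open>repeat_vec\<close> and its adjoint, and it kills every vector with zero block sum.\<close>

lemma amp_square_mult_vec:
  assumes X: "X \<in> carrier_mat D D" and f: "f \<in> carrier_vec (m * D)"
  shows "amp_square X m *\<^sub>v f = repeat_vec D m (X *\<^sub>v block_sum D m f)"
proof (rule block_eqI)
  fix b assume b: "b < m"
  have "block D (amp_square X m *\<^sub>v f) b = X *\<^sub>v block_sum D m f"
  proof (rule eq_vecI)
    fix a assume "a < dim_vec (X *\<^sub>v block_sum D m f)"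
    then have a: "a < D" using X by simp
    then show "block D (amp_square X m *\<^sub>v f) b $ a = (X *\<^sub>v block_sum D m f) $ a"
      using X sum_mult_mat_vec_block[OF X a, where f = f] unfolding amp_square_def
      by (simp add: block_matrix_mult_vec[of m _ D, OF _ f b a] del: index_mult_mat_vec)
  qed (use X in \<open>simp add: block_def\<close>)
  then show "block D (amp_square X m *\<^sub>v f) b = block D (repeat_vec D m (X *\<^sub>v block_sum D m f)) b"
    using X b by (simp add: block_repeat_vec)
qed (use X amp_square_carrier[OF X, of m] f in auto)

lemma amp_round_block:
  assumes X: "X \<in> carrier_mat D D" and f: "f \<in> carrier_vec (m * D)" and b: "b < m"
  shows "block D (amp_round X m *\<^sub>v f) b = X *\<^sub>v block D f b"
proof (rule eq_vecI)
  fix a assume "a < dim_vec (X *\<^sub>v block D f b)"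
  then have a: "a < D" using X by simp
  have "block D (amp_round X m *\<^sub>v f) b $ a
      = (\<Sum>c<m. ((if b = c then X else 0\<^sub>m D D) *\<^sub>v block D f c) $ a)"
    unfolding amp_round_def carrier_matD(1)[OF X]
    using X by (intro block_matrix_mult_vec[OF _ f b a]) auto
  also have "\<dots> = (\<Sum>c<m. if c = b then (X *\<^sub>v block D f c) $ a else 0)"
    using a X by (intro sum.cong) (auto simp: scalar_prod_def block_def)
  finally show "block D (amp_round X m *\<^sub>v f) b $ a = (X *\<^sub>v block D f b) $ a"
    using b by simp
qed (use X in \<open>simp add: block_def\<close>)

text \<open>Write \<open>S\<close> for the block sum. Block \<open>b\<close> of the image is
  \<open>X\<close> applied to block \<open>b\<close>, plus \<open>(I - X)/(m - 1)\<close> applied to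
  \<open>S\<close> minus block \<open>b\<close>; multiplying by \<open>m - 1\<close> clears the
  denominator. The two cases of interest are \<open>S = 0\<close> and equal blocks.\<close>

lemma amp_angle_block:
  assumes X: "X \<in> carrier_mat D D" and f: "f \<in> carrier_vec (m * D)" and b: "b < m" and a: "a < D"
    and m: "m > 1"
  shows "(of_nat m - 1) * block D (amp_angle X m *\<^sub>v f) b $ a
    = of_nat m * (X *\<^sub>v block D f b) $ a - block D f b $ a
      + block_sum D m f $ a - (X *\<^sub>v block_sum D m f) $ a"
proof -
  define F where "F = (\<lambda>b c :: nat. if b = c then X else (1 / (of_nat m - 1)) \<cdot>\<^sub>m (1\<^sub>m D - X))"
  have m1: "of_nat m - 1 \<noteq> (0 :: complex)" using m by simp
  have F: "F b c \<in> carrier_mat D D" for b c using X by (auto simp: F_def)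
  have angle: "amp_angle X m = block_matrix m D F" using X m by (auto simp: amp_angle_def F_def)
  have off: "(((1 / (of_nat m - 1)) \<cdot>\<^sub>m (1\<^sub>m D - X)) *\<^sub>v v) $ a
      = (v $ a - (X *\<^sub>v v) $ a) / (of_nat m - 1)" if v: "v \<in> carrier_vec D" for v
  proof -
    have "(((1 / (of_nat m - 1)) \<cdot>\<^sub>m (1\<^sub>m D - X)) *\<^sub>v v) $ a
        = (\<Sum>b<D. ((if a = b then v $ b else 0) - X $$ (a, b) * v $ b) / (of_nat m - 1))"
      using X v a by (subst mult_mat_vec_sum[of _ D D]) (auto simp: field_simps intro!: sum.cong)
    then show ?thesis
      using a mult_mat_vec_sum[OF X v a]
      by (simp add: sum_subtractf flip: sum_divide_distrib del: index_mult_mat_vec)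
  qed
  have "(of_nat m - 1) * block D (amp_angle X m *\<^sub>v f) b $ a
      = (of_nat m - 1) * (\<Sum>c<m. (F b c *\<^sub>v block D f c) $ a)"
    unfolding angle using block_matrix_mult_vec[of m F D, OF F f b a] by simp
  \<comment> \<open>The off-diagonal term is used for every \<open>c\<close>, with a correction at
    \<open>c = b\<close>, so that the main part sums to an expression in the block sum.\<close>
  also have "(\<Sum>c<m. (F b c *\<^sub>v block D f c) $ a)
      = (\<Sum>c<m. (block D f c $ a - (X *\<^sub>v block D f c) $ a) / (of_nat m - 1)
         + (if c = b then (X *\<^sub>v block D f c) $ a
              - (block D f c $ a - (X *\<^sub>v block D f c) $ a) / (of_nat m - 1) else 0))"
  proof (rule sum.cong)
    fix c assume "c \<in> {..<m}"
    show "(F b c *\<^sub>v block D f c) $ a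
      = (block D f c $ a - (X *\<^sub>v block D f c) $ a) / (of_nat m - 1)
         + (if c = b then (X *\<^sub>v block D f c) $ a
              - (block D f c $ a - (X *\<^sub>v block D f c) $ a) / (of_nat m - 1) else 0)"
      using off[OF block_carrier] unfolding F_def by (cases "b = c") (simp_all del: index_mult_mat_vec)
  qed simp
  also have "\<dots> = (block_sum D m f $ a - (X *\<^sub>v block_sum D m f) $ a) / (of_nat m - 1)
      + (X *\<^sub>v block D f b) $ a - (block D f b $ a - (X *\<^sub>v block D f b) $ a) / (of_nat m - 1)"
    using b a sum_mult_mat_vec_block[OF X a, where f = f and m = m]
    by (simp add: sum.distrib sum_subtractf block_def block_sum_def
        flip: sum_divide_distrib del: index_mult_mat_vec)
  also have "(of_nat m - 1) * \<dots> = of_nat m * (X *\<^sub>v block D f b) $ a - block D f b $ a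
      + block_sum D m f $ a - (X *\<^sub>v block_sum D m f) $ a"
  proof -
    have "t * ((S - Z) / t + p - (q - p) / t) = (t + 1) * p - q + S - Z" if "t \<noteq> 0"
      for t S Z p q :: complex
      using that by (simp add: field_simps)
    from this[OF m1] show ?thesis by (simp del: index_mult_mat_vec)
  qed
  finally show ?thesis .
qed

section \<open>Spectra and self-adjointness of the ampliations\<close>

lemma nonzero_block:
  assumes "f \<in> carrier_vec (m * D)" "f \<noteq> 0\<^sub>v (m * D)"
  obtains b where "b < m" "block D f b \<noteq> 0\<^sub>v D"
proof -
  have "block D (0\<^sub>v (m * D)) b = 0\<^sub>v D" if "b < m" for b
    using that by (intro eq_vecI) (auto simp: block_def block_index_less)
  then have "f = 0\<^sub>v (m * D)" if "\<And>b. b < m \<Longrightarrow> block D f b = 0\<^sub>v D"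
    using that by (intro block_eqI[OF assms(1)]) auto
  with assms(2) that show ?thesis by blast
qed

text \<open>The operator acts on each block separately, so any nonzero block of an eigenvector is an
  eigenvector of \<open>X\<close>. Hence spectral bounds for \<open>X\<close> carry over to
  \<open>amp_round X m\<close>.\<close>

lemma eigenvalue_amp_round:
  assumes X: "X \<in> carrier_mat D D" and c: "eigenvalue (amp_round X m) c"
  shows "eigenvalue X c"
proof -
  obtain f where f: "f \<in> carrier_vec (m * D)" "f \<noteq> 0\<^sub>v (m * D)" "amp_round X m *\<^sub>v f = c \<cdot>\<^sub>v f"
    using c amp_round_carrier[OF X, of m] by (auto simp: eigenvalue_def eigenvector_def)
  obtain b where b: "b < m" "block D f b \<noteq> 0\<^sub>v D" using nonzero_block[OF f(1,2)] by blast
  have "X *\<^sub>v block D f b = c \<cdot>\<^sub>v block D f b"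
    using amp_round_block[OF X f(1) b(1)] block_smult[OF f(1) b(1)] f(3) by simp
  then show ?thesis
    using X b(2) unfolding eigenvalue_def eigenvector_def by (intro exI[of _ "block D f b"]) auto
qed

text \<open>On vectors with zero block sum the operator acts blockwise as
  \<open>(m X - I)/(m - 1)\<close>. Solving for \<open>X\<close> on a nonzero block gives the stated
  eigenvalue.\<close>

lemma eigenvalue_amp_angle:
  assumes X: "X \<in> carrier_mat D D" and m: "m > 1"
    and f: "f \<in> carrier_vec (m * D)" "f \<noteq> 0\<^sub>v (m * D)" "block_sum D m f = 0\<^sub>v D"
    and eig: "amp_angle X m *\<^sub>v f = c \<cdot>\<^sub>v f"
  shows "eigenvalue X (((of_nat m - 1) * c + 1) / of_nat m)"
proof -
  obtain b where b: "b < m" "block D f b \<noteq> 0\<^sub>v D" using nonzero_block[OF f(1,2)] by blast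
  have "X *\<^sub>v block D f b = (((of_nat m - 1) * c + 1) / of_nat m) \<cdot>\<^sub>v block D f b"
  proof (rule eq_vecI)
    fix a assume "a < dim_vec ((((of_nat m - 1) * c + 1) / of_nat m) \<cdot>\<^sub>v block D f b)"
    then have a: "a < D" by (simp add: block_def)
    have "(X *\<^sub>v 0\<^sub>v D) $ a = 0" using X a by (subst mult_mat_vec_sum[OF X]) auto
    then have "(of_nat m - 1) * (c * block D f b $ a)
        = of_nat m * (X *\<^sub>v block D f b) $ a - block D f b $ a"
      using amp_angle_block[OF X f(1) b(1) a m] a unfolding f(3) eig block_smult[OF f(1) b(1)]
      by (simp add: carrier_vecD[OF block_carrier] del: index_mult_mat_vec)
    then show "(X *\<^sub>v block D f b) $ a = ((((of_nat m - 1) * c + 1) / of_nat m) \<cdot>\<^sub>v block D f b) $ a"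
      using m a by (simp add: carrier_vecD[OF block_carrier] field_simps del: index_mult_mat_vec)
  qed (use X in \<open>simp add: block_def\<close>)
  then show ?thesis
    using X b(2) unfolding eigenvalue_def eigenvector_def by (intro exI[of _ "block D f b"]) auto
qed

lemma self_adjoint_amp_round:
  assumes "X \<in> carrier_mat D D" "mat_adjoint X = X"
  shows "mat_adjoint (amp_round X m) = amp_round X m"
  unfolding amp_round_def carrier_matD(1)[OF assms(1)]
proof (rule block_matrix_self_adjoint)
  fix b c a a' assume "a < D" "a' < D"
  then show "(if b = c then X else 0\<^sub>m D D) $$ (a, a') = cnj ((if c = b then X else 0\<^sub>m D D) $$ (a', a))"
    using self_adjointD[OF assms(2,1), of a a'] by simp
qed

lemma self_adjoint_amp_angle:
  assumes "X \<in> carrier_mat D D" "mat_adjoint X = X"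
  shows "mat_adjoint (amp_angle X m) = amp_angle X m"
proof (cases "m = 1")
  case False
  have "mat_adjoint (block_matrix m D F) = block_matrix m D F"
    if F: "F = (\<lambda>b c. if b = c then X else (1 / (of_nat m - 1)) \<cdot>\<^sub>m (1\<^sub>m D - X))" for F
  proof (rule block_matrix_self_adjoint)
    fix b c a a' assume "a < D" "a' < D"
    then show "F b c $$ (a, a') = cnj (F c b $$ (a', a))"
      using self_adjointD[OF assms(2,1), of a a'] assms(1) by (simp add: F)
  qed
  then show ?thesis using False unfolding amp_angle_def carrier_matD(1)[OF assms(1)] by simp
qed (use assms in \<open>simp add: amp_angle_def\<close>)

text \<open>Serves the degenerate case \<open>m = 1\<close>, where the spectral bounds pin every
  eigenvalue to \<open>1\<close>; diagonalizability then gives the identity.\<close>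

lemma self_adjoint_eigenvalues_1:
  assumes X: "mat_adjoint X = X" "X \<in> carrier_mat D D" "\<And>c. eigenvalue X c \<Longrightarrow> Re c = 1"
  shows "X = 1\<^sub>m D"
proof -
  obtain g \<mu> where g: "orthonormal_family D D g"
    "\<And>i. i < D \<Longrightarrow> X *\<^sub>v g i = of_real (\<mu> i) \<cdot>\<^sub>v g i"
    "\<And>i l. i \<le> l \<Longrightarrow> l < D \<Longrightarrow> \<mu> l \<le> \<mu> i"
    by (rule sorted_eigenbasis[OF X(1,2)]) (rule that)
  have "\<mu> i = 1" if "i < D" for i
  proof -
    have "g i \<bullet>c g i = 1" "g i \<in> carrier_vec D" using g(1) that by (auto simp: orthonormal_family_def)
    moreover from this have "g i \<noteq> 0\<^sub>v D" by auto
    ultimately have "eigenvalue X (of_real (\<mu> i))"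
      using X(2) g(2)[OF that] unfolding eigenvalue_def eigenvector_def by (intro exI[of _ "g i"]) auto
    then show ?thesis using X(3) by fastforce
  qed
  then have eig: "X *\<^sub>v g i = 1 \<cdot>\<^sub>v g i" if "i < D" for i using g(2)[OF that] that by simp
  show ?thesis
  proof (rule eq_matI)
    fix a b assume "a < dim_row (1\<^sub>m D)" "b < dim_col (1\<^sub>m D)"
    then show "X $$ (a, b) = 1\<^sub>m D $$ (a, b)"
      using eigenbasis_entry[OF g(1) X(2) eig, of a b] orthonormal_family_complete[OF g(1), of a b]
      by simp
  qed (use X(2) in auto)
qed

text \<open>For \<open>m > 1\<close> each block is \<open>v\<close> and the block sum is
  \<open>m v\<close>, so the terms with \<open>X\<close> cancel in \<open>amp_angle_block\<close>
  and \<open>(m - 1) v\<close> is left. For \<open>m = 1\<close> the bounds force \<open>X\<close>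
  to be the identity.\<close>

lemma amp_angle_repeat_vec:
  assumes X: "mat_adjoint X = X" "X \<in> carrier_mat D D" and m: "m > 0"
    and bounds: "\<And>c. eigenvalue X c \<Longrightarrow> 1 / real m \<le> Re c \<and> Re c \<le> 1"
    and v: "v \<in> carrier_vec D"
  shows "amp_angle X m *\<^sub>v repeat_vec D m v = repeat_vec D m v"
proof (cases "m = 1")
  case True
  have "X = 1\<^sub>m D" using bounds True by (intro self_adjoint_eigenvalues_1[OF X]) force
  then show ?thesis using True by (simp add: amp_angle_def repeat_vec_def)
next
  case False
  then have m1: "m > 1" using m by simp
  show ?thesis
  proof (rule block_eqI)
    fix b assume b: "b < m"
    show "block D (amp_angle X m *\<^sub>v repeat_vec D m v) b = block D (repeat_vec D m v) b"
    proof (rule eq_vecI)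
      fix a assume "a < dim_vec (block D (repeat_vec D m v) b)"
      then have a: "a < D" by (simp add: block_def)
      have Xmv: "X *\<^sub>v (of_nat m \<cdot>\<^sub>v v) = of_nat m \<cdot>\<^sub>v (X *\<^sub>v v)"
        using X(2) v by (rule mult_mat_vec)
      have "(of_nat m - 1) * block D (amp_angle X m *\<^sub>v repeat_vec D m v) b $ a
          = (of_nat m - 1) * v $ a"
        unfolding amp_angle_block[OF X(2) repeat_vec_carrier b a m1] block_repeat_vec[OF v b]
          block_sum_repeat_vec[OF v] Xmv
        using X(2) v a by (simp add: algebra_simps del: index_mult_mat_vec)
      then show "block D (amp_angle X m *\<^sub>v repeat_vec D m v) b $ a = block D (repeat_vec D m v) b $ a"
        using m1 by (simp add: block_repeat_vec[OF v b] del: index_mult_mat_vec)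
    qed (simp add: block_def)
  qed (use amp_angle_carrier[OF X(2), of m] in auto)
qed

text \<open>The old basis \<open>e\<^sub>i\<close> gives the unit vectors \<open>f\<^sub>i = m\<^sup>-\<^sup>1\<^sup>/\<^sup>2 e\<^sub>i \<otimes> (1, \<dots>, 1)\<close>,
  which are fixed by \<open>amp_angle Y m\<close>. On their orthogonal complement all
  \<open>amp_square (X j) m\<close> vanish, so the complement may be ordered by \<open>amp_angle Y m\<close> alone.\<close>

lemma common_eigenbasis_step:
  assumes common: "common_eigenbasis D n X"
    and Y: "mat_adjoint Y = Y" "Y \<in> carrier_mat D D" and m: "m > 0"
    and bounds: "\<And>c. eigenvalue Y c \<Longrightarrow> 1 / real m \<le> Re c \<and> Re c \<le> 1"
  shows "common_eigenbasis (m * D) (Suc n) (\<lambda>j. if j \<le> n then amp_square (X j) m else amp_angle Y m)"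
proof -
  have X: "X j \<in> carrier_mat D D" if "j \<le> n" for j
    using common that unfolding common_eigenbasis_def by simp
  obtain e \<mu> where e: "orthonormal_family D D e" and
    \<mu>: "\<forall>j\<le>n. (\<forall>i<D. X j *\<^sub>v e i = of_real (\<mu> j i) \<cdot>\<^sub>v e i \<and> 0 \<le> (\<mu> j i :: real)) \<and>
           (\<forall>i l. i \<le> l \<longrightarrow> l < D \<longrightarrow> \<mu> j l \<le> \<mu> j i)"
    using common unfolding common_eigenbasis_def by (elim conjE exE) (rule that)
  have ec: "e i \<in> carrier_vec D" if "i < D" for i using e that by (auto simp: orthonormal_family_def)
  \<comment> \<open>Repeating a vector \<open>m\<close> times multiplies its norm by the square root
    of \<open>m\<close>; \<open>s\<close> undoes this.\<close>
  define s :: complex where "s = of_real (1 / sqrt m)"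
  have s: "s * (cnj s * of_nat m) = 1"
  proof -
    have "s * cnj s * of_nat m = of_real (1 / sqrt (real m) * (1 / sqrt (real m)) * real m)"
      by (simp only: s_def complex_cnj_complex_of_real of_real_mult of_real_of_nat_eq)
    also have "1 / sqrt (real m) * (1 / sqrt (real m)) * real m = 1" using m by (simp add: field_simps)
    finally show ?thesis by (simp add: mult.assoc)
  qed
  then have s0: "s \<noteq> 0" by auto
  define f where "f i = s \<cdot>\<^sub>v repeat_vec D m (e i)" for i
  have fc: "f i \<in> carrier_vec (m * D)" for i by (simp add: f_def)
  have ff: "f i \<bullet>c f l = (if i = l then 1 else 0)" if "i < D" "l < D" for i l
  proof -
    have "f i \<bullet>c f l = s * cnj s * (repeat_vec D m (e i) \<bullet>c repeat_vec D m (e l))"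
      by (simp add: f_def cscalar_prod_smult_right[of _ "m * D"] cscalar_prod_smult_left[of _ "m * D"])
    also have "repeat_vec D m (e i) \<bullet>c repeat_vec D m (e l) = of_nat m * (e i \<bullet>c e l)"
      using ec that by (simp add: cscalar_prod_repeat_vec block_sum_repeat_vec cscalar_prod_smult_left[of _ D])
    finally show ?thesis using s e that by (auto simp: orthonormal_family_def)
  qed
  have f: "orthonormal_family (m * D) D f" using ff fc by (simp add: orthonormal_family_def)
  have le: "D \<le> m * D" using m by simp
  have eig_f: "amp_angle Y m *\<^sub>v f i = of_real 1 \<cdot>\<^sub>v f i" if "i < D" for i
    using amp_angle_repeat_vec[OF Y m bounds ec[OF that]] amp_angle_carrier[OF Y(2), of m]
    by (simp add: f_def mult_mat_vec[of _ "m * D" "m * D"])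
  obtain g \<kappa> where g: "orthonormal_family (m * D) (m * D) g"
    "\<And>i. i < D \<Longrightarrow> g i = f i \<and> \<kappa> i = 1"
    "\<And>i. i < m * D \<Longrightarrow> amp_angle Y m *\<^sub>v g i = of_real (\<kappa> i) \<cdot>\<^sub>v g i"
    "\<And>i l. D \<le> i \<Longrightarrow> i \<le> l \<Longrightarrow> l < m * D \<Longrightarrow> \<kappa> l \<le> \<kappa> i"
    by (rule sorted_eigenbasis_extension[where \<nu> = "\<lambda>_. 1",
          OF self_adjoint_amp_angle[OF Y(2,1)] amp_angle_carrier[OF Y(2)] f le eig_f]) (assumption, rule that)
  have gc: "g i \<in> carrier_vec (m * D)" if "i < m * D" for i
    using g(1) that by (auto simp: orthonormal_family_def)
  \<comment> \<open>The new basis vectors are orthogonal to the first \<open>D\<close>, which are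
    multiples of the repeated \<open>e l\<close>; by adjointness their block sums are orthogonal to
    the basis \<open>e\<close>.\<close>
  have g0: "block_sum D m (g i) = 0\<^sub>v D" if i: "D \<le> i" "i < m * D" for i
  proof (rule orthonormal_family_eqI[OF e])
    fix l assume l: "l < D"
    then have "g i \<bullet>c g l = 0" using g(1) i by (auto simp: orthonormal_family_def)
    then have "g i \<bullet>c repeat_vec D m (e l) = 0"
      using g(2)[OF l] gc[OF i(2)] s0 by (simp add: f_def cscalar_prod_smult_right[of _ "m * D"])
    then show "block_sum D m (g i) \<bullet>c e l = 0\<^sub>v D \<bullet>c e l"
      using ec[OF l] gc[OF i(2)] by (simp add: cscalar_prod_repeat_vec)
  qed auto
  have \<kappa>: "0 \<le> \<kappa> i \<and> \<kappa> i \<le> 1" if i: "D \<le> i" "i < m * D" for i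
  proof -
    \<comment> \<open>For \<open>m = 1\<close> there is no index with
      \<open>D \<le> i < m * D\<close>.\<close>
    have m1: "m > 1" using i m by (cases "m = 1") auto
    have "g i \<bullet>c g i = 1" using g(1) i by (auto simp: orthonormal_family_def)
    then have "g i \<noteq> 0\<^sub>v (m * D)" using gc[OF i(2)] by auto
    then have "eigenvalue Y (((of_nat m - 1) * of_real (\<kappa> i) + 1) / of_nat m)"
      using eigenvalue_amp_angle[OF Y(2) m1 gc[OF i(2)] _ g0[OF i] g(3)[OF i(2)]] by simp
    moreover have "((of_nat m - 1) * of_real (\<kappa> i) + 1) / of_nat m
        = complex_of_real (((real m - 1) * \<kappa> i + 1) / real m)" by simp
    \<comment> \<open>The map from \<open>\<kappa>\<close> to
      \<open>((m - 1) \<kappa> + 1)/m\<close> sends the interval from \<open>0\<close> to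
      \<open>1\<close> onto that from \<open>1/m\<close> to \<open>1\<close>, so the bounds on
      \<open>Y\<close> are exactly those wanted for \<open>\<kappa> i\<close>.\<close>
    ultimately have "1 / real m \<le> ((real m - 1) * \<kappa> i + 1) / real m"
      "((real m - 1) * \<kappa> i + 1) / real m \<le> 1"
      using bounds by (metis Re_complex_of_real)+
    then have "0 \<le> (real m - 1) * \<kappa> i" "(real m - 1) * \<kappa> i \<le> (real m - 1) * 1"
      using m by (auto simp: field_simps)
    then show ?thesis using m1 by (simp add: zero_le_mult_iff)
  qed
  \<comment> \<open>An old operator has its eigenvalues scaled by \<open>m\<close> and followed by
    zeros; the new one has \<open>D\<close> ones followed by its sorted tail.\<close>
  define \<mu>' where "\<mu>' j i = (if j \<le> n then (if i < D then real m * \<mu> j i else 0) else \<kappa> i)" for j i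
  show ?thesis unfolding common_eigenbasis_def
  proof (intro conjI exI[of _ g] exI[of _ \<mu>'] allI impI)
    show "(if j \<le> n then amp_square (X j) m else amp_angle Y m) \<in> carrier_mat (m * D) (m * D)" for j
      using amp_square_carrier[OF X] amp_angle_carrier[OF Y(2)] by simp
    show "orthonormal_family (m * D) (m * D) g" by (fact g(1))
  next
    fix j i assume i: "i < m * D"
    show "0 \<le> \<mu>' j i"
      using \<mu> \<kappa>[of i] g(2)[of i] i by (cases "i < D") (auto simp: \<mu>'_def)
    show "(if j \<le> n then amp_square (X j) m else amp_angle Y m) *\<^sub>v g i = of_real (\<mu>' j i) \<cdot>\<^sub>v g i"
    proof (cases "j \<le> n")
      case False
      then show ?thesis using g(3)[OF i] by (simp add: \<mu>'_def)
    next
      case j: True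
      note sq = amp_square_mult_vec[OF X[OF j] gc[OF i]]
      show ?thesis
      proof (cases "i < D")
        case True
        have "block_sum D m (g i) = (s * of_nat m) \<cdot>\<^sub>v e i"
          using g(2)[OF True] ec[OF True]
          by (intro eq_vecI) (auto simp: block_sum_def f_def repeat_vec_def block_index_less)
        then have "X j *\<^sub>v block_sum D m (g i) = (s * of_nat m * of_real (\<mu> j i)) \<cdot>\<^sub>v e i"
          using \<mu> j True X[OF j] ec[OF True]
          by (simp add: mult_mat_vec[of _ D D] smult_smult_assoc)
        moreover have "repeat_vec D m ((s * of_nat m * of_real (\<mu> j i)) \<cdot>\<^sub>v e i)
            = of_real (real m * \<mu> j i) \<cdot>\<^sub>v f i"
        proof (rule eq_vecI)
          fix r assume "r < dim_vec (of_real (real m * \<mu> j i) \<cdot>\<^sub>v f i)"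
          then have "r < m * D" by (simp add: f_def repeat_vec_def)
          moreover from this have "r mod D < D" by (auto intro!: mod_less_divisor intro: gr0I)
          ultimately show "repeat_vec D m ((s * of_nat m * of_real (\<mu> j i)) \<cdot>\<^sub>v e i) $ r
              = (of_real (real m * \<mu> j i) \<cdot>\<^sub>v f i) $ r"
            using ec[OF True] by (simp add: f_def repeat_vec_def)
        qed (simp add: f_def repeat_vec_def)
        ultimately show ?thesis using sq j True g(2)[OF True] by (simp add: \<mu>'_def)
      next
        case False
        have "X j *\<^sub>v 0\<^sub>v D = 0\<^sub>v D" using X[OF j] by (intro eq_vecI) auto
        moreover have "repeat_vec D m (0\<^sub>v D) = 0 \<cdot>\<^sub>v g i"
        proof (rule eq_vecI)
          fix r assume "r < dim_vec (0 \<cdot>\<^sub>v g i)"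
          then have "r < m * D" using gc[OF i] by simp
          moreover from this have "r mod D < D" by (auto intro!: mod_less_divisor intro: gr0I)
          ultimately show "repeat_vec D m (0\<^sub>v D) $ r = (0 \<cdot>\<^sub>v g i) $ r"
            using gc[OF i] by (simp add: repeat_vec_def)
        qed (use gc[OF i] in \<open>simp add: repeat_vec_def\<close>)
        ultimately show ?thesis using sq j False g0[of i] i by (simp add: \<mu>'_def)
      qed
    qed
  next
    fix j i l assume il: "i \<le> l" "l < m * D"
    \<comment> \<open>The order survives across index \<open>D\<close>: the scaled old eigenvalues
      are at least \<open>0\<close>, and the tail of \<open>\<kappa>\<close> is at most
      \<open>1\<close>.\<close>
    show "\<mu>' j l \<le> \<mu>' j i"
    proof (cases "j \<le> n")
      case True
      then show ?thesis using \<mu> il by (auto simp: \<mu>'_def mult_left_mono)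
    next
      case False
      then show ?thesis
        using \<kappa>[of l] g(2)[of i] g(2)[of l] g(4)[of i l] il
        by (cases "i < D"; cases "l < D") (auto simp: \<mu>'_def)
    qed
  qed
qed

subsection \<open>Total dilation\<close>

text \<open>Total dilation of one operator with the isometries fixed as the coordinate embeddings.
  Since this choice depends on neither operator, it is automatically simultaneous for a
  family.\<close>

definition diag_blocks :: "nat \<Rightarrow> nat \<Rightarrow> complex mat \<Rightarrow> complex mat \<Rightarrow> bool" where
  "diag_blocks D m B X \<longleftrightarrow> B \<in> carrier_mat (m * D) (m * D) \<and>
     (\<forall>b<m. \<forall>a<D. \<forall>c<D. B $$ (b * D + a, b * D + c) = X $$ (a, c))"

lemma diag_blocks_amp_square: "X \<in> carrier_mat D D \<Longrightarrow> diag_blocks D m (amp_square X m) X"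
  and diag_blocks_amp_round: "X \<in> carrier_mat D D \<Longrightarrow> diag_blocks D m (amp_round X m) X"
  by (auto simp: diag_blocks_def amp_square_def amp_round_def block_matrix_entry)

lemma diag_blocks_amp_angle: "X \<in> carrier_mat D D \<Longrightarrow> diag_blocks D m (amp_angle X m) X"
  by (auto simp: diag_blocks_def amp_angle_def block_matrix_entry)

text \<open>Small diagonal block \<open>b\<close> sits inside large diagonal block
  \<open>b div p\<close>, as its diagonal block number \<open>b mod p\<close>.\<close>

lemma diag_blocks_trans:
  assumes "diag_blocks D p X A" "diag_blocks (p * D) m B X"
  shows "diag_blocks D (m * p) B A"
  unfolding diag_blocks_def
proof (intro conjI allI impI)
  show "B \<in> carrier_mat (m * p * D) (m * p * D)"
    using assms(2) by (simp add: diag_blocks_def mult.assoc)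
  fix b a c assume *: "b < m * p" "a < D" "c < D"
  then have "p > 0" by (auto intro: gr0I)
  then have b: "b div p < m" "b mod p < p" using * by (auto simp: less_mult_imp_div_less)
  have eq: "b * D + x = (b div p) * (p * D) + ((b mod p) * D + x)" for x
    by (metis add.assoc add_mult_distrib div_mult_mod_eq mult.assoc)
  have "B $$ (b * D + a, b * D + c) = X $$ ((b mod p) * D + a, (b mod p) * D + c)"
    unfolding eq[of a] eq[of c] using assms(2) block_index_less[OF b(2)] b(1) *
    unfolding diag_blocks_def by blast
  also have "\<dots> = A $$ (a, c)" using assms(1) b * by (simp add: diag_blocks_def)
  finally show "B $$ (b * D + a, b * D + c) = A $$ (a, c)" .
qed

text \<open>With \<open>V i\<close> the embedding of summand \<open>i\<close>, the compression of an
  operator by \<open>V i\<close> is its diagonal block \<open>i\<close>, and the ranges of the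
  \<open>V i\<close> are the summands.\<close>

lemma diag_blocks_imp_totally_dilates:
  assumes A: "\<And>j. j \<le> n \<Longrightarrow> A j \<in> carrier_mat d d"
    and B: "\<And>j. j \<le> n \<Longrightarrow> diag_blocks d k (B j) (A j)"
  shows "totally_dilates d k n B A"
proof -
  interpret vec_space "TYPE(complex)" "k * d" .
  define V :: "nat \<Rightarrow> complex mat" where
    "V i = mat (k * d) d (\<lambda>(r, c). if r = i * d + c then 1 else 0)" for i
  have V: "V i \<in> carrier_mat (k * d) d" for i by (simp add: V_def)
  have adj: "mat_adjoint (V i) \<in> carrier_mat d (k * d)" for i
    using V[of i] by (intro carrier_matI) auto
  have less: "i * d + c < k * d" if "i < k" "c < d" for i c
    using block_index_less[OF that] .
  have Vx: "(V i *\<^sub>v x) $ r = (if r div d = i then x $ (r mod d) else 0)"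
    if "x \<in> carrier_vec d" "r < k * d" for i x r
  proof -
    have d: "d > 0" using that by (auto intro: gr0I)
    have "(V i *\<^sub>v x) $ r = (\<Sum>c<d. (if r = i * d + c then 1 else 0) * x $ c)"
      using that by (subst mult_mat_vec_sum[OF V]) (auto simp: V_def)
    also have "\<dots> = (\<Sum>c<d. if c = r mod d then (if r div d = i then x $ c else 0) else 0)"
    proof (rule sum.cong)
      fix c assume "c \<in> {..<d}"
      then have "r = i * d + c \<longleftrightarrow> c = r mod d \<and> r div d = i"
        using d by (metis add.commute div_mult_mod_eq div_mult_self1 div_less lessThan_iff
            less_not_refl3 mod_less mod_mult_self1 add_0 add_cancel_left_right)
      then show "(if r = i * d + c then 1 else 0) * x $ c
          = (if c = r mod d then (if r div d = i then x $ c else 0) else 0)" by auto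
    qed simp
    finally show ?thesis using d by simp
  qed
  have VBV: "(mat_adjoint (V i) * M * V i) $$ (a, c) = M $$ (i * d + a, i * d + c)"
    if M: "M \<in> carrier_mat (k * d) (k * d)" and ac: "a < d" "c < d" and i: "i < k" for i M a c
  proof -
    have "(M * V i) $$ (r, c) = M $$ (r, i * d + c)" if "r < k * d" for r
    proof -
      have "(M * V i) $$ (r, c) = (\<Sum>s<k * d. M $$ (r, s) * (if s = i * d + c then 1 else 0))"
        using that M ac by (simp add: V_def scalar_prod_def atLeast0LessThan)
      also have "\<dots> = (\<Sum>s<k * d. if s = i * d + c then M $$ (r, s) else 0)"
        by (intro sum.cong) auto
      finally show ?thesis using less[OF i ac(2)] by simp
    qed
    then have "(mat_adjoint (V i) * (M * V i)) $$ (a, c)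
        = (\<Sum>r<k * d. (if r = i * d + a then 1 else 0) * M $$ (r, i * d + c))"
      using M ac V[of i] by (simp add: scalar_prod_def atLeast0LessThan mat_adjoint_index)
        (auto simp: V_def intro!: sum.cong)
    also have "\<dots> = (\<Sum>r<k * d. if r = i * d + a then M $$ (r, i * d + c) else 0)"
      by (intro sum.cong) auto
    also have "\<dots> = M $$ (i * d + a, i * d + c)" using less[OF i ac(1)] by simp
    finally show ?thesis unfolding assoc_mult_mat[OF adj M V] .
  qed
  have isometry: "mat_adjoint (V i) * V i = 1\<^sub>m d" if "i < k" for i
  proof (rule eq_matI)
    fix a c assume *: "a < dim_row (1\<^sub>m d)" "c < dim_col (1\<^sub>m d)"
    \<comment> \<open>The isometry property is the block formula \<open>VBV\<close> for the identity
      operator.\<close>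
    have "mat_adjoint (V i) * V i = mat_adjoint (V i) * 1\<^sub>m (k * d) * V i"
      using right_mult_one_mat[OF adj[of i]] by simp
    then show "(mat_adjoint (V i) * V i) $$ (a, c) = 1\<^sub>m d $$ (a, c)"
      using VBV[of "1\<^sub>m (k * d)" a c i] * that less by simp
  qed (use V[of i] in auto)
  have orth: "(V i *\<^sub>v x) \<bullet>c (V l *\<^sub>v y) = 0"
    if "i \<noteq> l" "x \<in> carrier_vec d" "y \<in> carrier_vec d" for i l x y
  proof -
    have "V l *\<^sub>v y \<in> carrier_vec (k * d)" using mult_mat_vec_carrier[OF V that(3)] .
    then show ?thesis using that
      by (auto simp: cscalar_prod_sum Vx simp del: index_mult_mat_vec intro!: sum.neutral)
  qed
  define R where "R = (\<Union>i<k. (\<lambda>x. V i *\<^sub>v x) ` carrier_vec d)"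
  have R: "R \<subseteq> carrier_vec (k * d)" using V by (auto simp: R_def intro: mult_mat_vec_carrier)
  \<comment> \<open>The unit vector with index \<open>r\<close> is the image under
    \<open>V (r div d)\<close> of the one with index \<open>r mod d\<close>, so the ranges
    span.\<close>
  have "set (unit_vecs (k * d)) \<subseteq> R"
  proof
    fix u :: "complex vec" assume "u \<in> set (unit_vecs (k * d))"
    then obtain r where r: "r < k * d" "u = unit_vec (k * d) r" by (auto simp: unit_vecs_def)
    then have d: "d > 0" by (auto intro: gr0I)
    have "V (r div d) *\<^sub>v unit_vec d (r mod d) = u"
    proof (rule eq_vecI)
      fix s assume "s < dim_vec u"
      then have s: "s < k * d" using r by simp
      have "s = r \<longleftrightarrow> s div d = r div d \<and> s mod d = r mod d" by (metis div_mult_mod_eq)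
      then show "(V (r div d) *\<^sub>v unit_vec d (r mod d)) $ s = u $ s"
        using s r d by (auto simp: Vx simp del: index_mult_mat_vec)
    qed (use r V[of "r div d"] in auto)
    moreover have "r div d < k" using r by (simp add: less_mult_imp_div_less)
    ultimately show "u \<in> R" unfolding R_def by force
  qed
  then have "span (set (unit_vecs (k * d))) \<subseteq> span R" by (rule span_is_monotone)
  moreover have "span R \<subseteq> carrier_vec (k * d)" using span_is_subset2[OF R] by simp
  ultimately have span: "span R = carrier_vec (k * d)"
    unfolding span_unit_vecs_is_carrier by blast
  have VBV_eq: "mat_adjoint (V i) * B j * V i = A j" if "i < k" "j \<le> n" for i j
  proof (rule eq_matI)
    fix a c assume "a < dim_row (A j)" "c < dim_col (A j)"
    then show "(mat_adjoint (V i) * B j * V i) $$ (a, c) = A j $$ (a, c)"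
      using B[OF that(2)] A[OF that(2)] VBV[of "B j" a c i] that(1) by (simp add: diag_blocks_def)
  qed (use A[OF that(2)] V[of i] in auto)
  show ?thesis
    unfolding totally_dilates_def
  proof (intro conjI exI[of _ V] allI impI ballI)
    show "LinearCombinations.module.span class_ring (module_vec TYPE(complex) (k * d))
        (\<Union>i<k. (*\<^sub>v) (V i) ` carrier_vec d) = carrier_vec (k * d)"
      using span by (simp add: R_def)
  qed (use A B V isometry orth VBV_eq in \<open>auto simp: diag_blocks_def\<close>)
qed

section \<open>Spectral bounds from the operator order, and the induction\<close>

text \<open>An eigenvector of \<open>X\<close> for \<open>c\<close> is one of \<open>I - X\<close>
  for \<open>1 - c\<close> and of \<open>X - I/m\<close> for \<open>c - 1/m\<close>. Evaluating both
  positive forms at it gives these numbers times its squared norm \<open>s > 0\<close>.\<close>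

lemma eigenvalue_loewner_bounds:
  assumes X: "X \<in> carrier_mat D D" and c: "eigenvalue X c"
    and upper: "loewner_le D X (1\<^sub>m D)" and lower: "loewner_le D ((1 / of_nat m) \<cdot>\<^sub>m 1\<^sub>m D) X"
  shows "1 / real m \<le> Re c \<and> Re c \<le> 1"
proof -
  obtain v where v: "v \<in> carrier_vec D" "v \<noteq> 0\<^sub>v D" "X *\<^sub>v v = c \<cdot>\<^sub>v v"
    using X c by (auto simp: eigenvalue_def eigenvector_def)
  define s where "s = (\<Sum>a<D. (cmod (v $ a))\<^sup>2)"
  have vv: "v \<bullet>c v = of_real s" unfolding s_def by (rule cscalar_prod_self[OF v(1)])
  have "v \<bullet>c v \<noteq> 0" using v by simp
  moreover have "s \<ge> 0" by (simp add: s_def sum_nonneg)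
  ultimately have s: "s > 0" using vv by auto
  have Xv: "(\<Sum>b<D. X $$ (a, b) * v $ b) = c * v $ a" if "a < D" for a
    using mult_mat_vec_sum[OF X v(1) that] v that by simp
  have "(1\<^sub>m D - X) *\<^sub>v v = (1 - c) \<cdot>\<^sub>v v"
  proof (rule eq_vecI)
    fix a assume "a < dim_vec ((1 - c) \<cdot>\<^sub>v v)"
    then have a: "a < D" using v by simp
    have "((1\<^sub>m D - X) *\<^sub>v v) $ a = (\<Sum>b<D. (if a = b then v $ b else 0) - X $$ (a, b) * v $ b)"
      using X v a by (subst mult_mat_vec_sum[of _ D D]) (auto simp: algebra_simps intro!: sum.cong)
    then show "((1\<^sub>m D - X) *\<^sub>v v) $ a = ((1 - c) \<cdot>\<^sub>v v) $ a"
      using v a Xv[OF a] by (simp add: sum_subtractf algebra_simps del: index_mult_mat_vec)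
  qed (use X v in auto)
  moreover have "(X - (1 / of_nat m) \<cdot>\<^sub>m 1\<^sub>m D) *\<^sub>v v = (c - 1 / of_nat m) \<cdot>\<^sub>v v"
  proof (rule eq_vecI)
    fix a assume "a < dim_vec ((c - 1 / of_nat m) \<cdot>\<^sub>v v)"
    then have a: "a < D" using v by simp
    have "((X - (1 / of_nat m) \<cdot>\<^sub>m 1\<^sub>m D) *\<^sub>v v) $ a
        = (\<Sum>b<D. X $$ (a, b) * v $ b - (if a = b then 1 / of_nat m * v $ b else 0))"
      using X v a by (subst mult_mat_vec_sum[of _ D D]) (auto simp: algebra_simps intro!: sum.cong)
    then show "((X - (1 / of_nat m) \<cdot>\<^sub>m 1\<^sub>m D) *\<^sub>v v) $ a = ((c - 1 / of_nat m) \<cdot>\<^sub>v v) $ a"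
      using v a Xv[OF a] by (simp add: sum_subtractf algebra_simps del: index_mult_mat_vec)
  qed (use X v in auto)
  ultimately have "0 \<le> Re ((1 - c) * of_real s)" "0 \<le> Re ((c - 1 / of_nat m) * of_real s)"
    using upper lower v(1) unfolding loewner_le_def positive_op_def
    by (metis cscalar_prod_smult_left vv)+
  moreover have "Re ((c - 1 / of_nat m) * of_real s) = (Re c - 1 / real m) * s"
    by (simp add: complex_eq_iff Re_divide_of_nat)
  ultimately show ?thesis using s by (auto simp: zero_le_mult_iff)
qed

theorem theorem2p2:
  fixes d n :: nat and A :: "nat \<Rightarrow> complex mat" and k :: "nat \<Rightarrow> nat" and K :: nat
  assumes "n \<ge> 1"
    and "\<And>j. j \<le> n \<Longrightarrow> positive_op d (A j)"
    and "\<And>j. j \<in> {1..n} \<Longrightarrow> k j > 0"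
    and "\<And>j. j \<in> {1..n} \<Longrightarrow> loewner_le d (A j) (1\<^sub>m d)"
    and "\<And>j. j \<in> {1..n} \<Longrightarrow> loewner_le d ((1 / of_nat (k j)) \<cdot>\<^sub>m 1\<^sub>m d) (A j)"
    and "k 0 = 1"
    and "K = (\<Prod>j=1..n. k j)"
  shows "(\<exists>B. (\<forall>j\<le>n. positive_op (K * d) (B j)) \<and>
              monotone_family (K * d) n B \<and> totally_dilates d K n B A) \<and>
         (let k' = (\<lambda>j. \<Prod>l\<in>{0..<j}. k l);
              k'' = (\<lambda>j. \<Prod>l\<in>{j+1..n}. k l);
              B = (\<lambda>j. amp_square (amp_angle (amp_round (A j) (k' j)) (k j)) (k'' j))
          in (\<forall>j\<le>n. positive_op (K * d) (B j)) \<and>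
             monotone_family (K * d) n B \<and> totally_dilates d K n B A)"
proof -
  have A: "A j \<in> carrier_mat d d" "mat_adjoint (A j) = A j" if "j \<le> n" for j
    using assms(2)[OF that] by (auto simp: positive_op_def)
  define k' where "k' = (\<lambda>j. \<Prod>l\<in>{0..<j}. k l)"
  \<comment> \<open>The extra argument \<open>N\<close> is the last index, so that
    \<open>B N\<close> is the construction for the operators with indices up to \<open>N\<close>, on
    which the induction runs.\<close>
  define k'' where "k'' = (\<lambda>N j. \<Prod>l\<in>{j+1..N}. k l)"
  define Y where "Y j = amp_angle (amp_round (A j) (k' j)) (k j)" for j
  define B where "B N j = amp_square (Y j) (k'' N j)" for N j
  have k'_Suc: "k' (Suc j) = k j * k' j" for j by (simp add: k'_def mult.commute)
  \<comment> \<open>The product defining \<open>k'\<close> starts at index \<open>0\<close>, where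
    the factor is \<open>k 0 = 1\<close>.\<close>
  have k'_eq: "k' (Suc N) = (\<Prod>j=1..N. k j)" for N
    by (induction N) (simp_all add: k'_def assms(6))
  have round: "amp_round (A j) (k' j) \<in> carrier_mat (k' j * d) (k' j * d)" if "j \<le> n" for j
    using A(1)[OF that] by (rule amp_round_carrier)
  have Y: "Y j \<in> carrier_mat (k' (Suc j) * d) (k' (Suc j) * d)" if "j \<le> n" for j
    using amp_angle_carrier[OF round[OF that], of "k j"] by (simp add: Y_def k'_Suc mult.assoc)
  have common: "common_eigenbasis (k' (Suc N) * d) N (B N)" if "N \<le> n" for N
    using that
  proof (induction N)
    case 0
    \<comment> \<open>All three ampliations are by \<open>1\<close>, from \<open>k 0 = 1\<close> and
      empty products, so the base case is a sorted eigenbasis of \<open>A 0\<close>.\<close>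
    have B0: "B 0 0 = A 0"
      using A(1)[of 0] amp_round_1[of "A 0" d] amp_square_1[of "A 0" d] assms(6)
      by (simp add: B_def k''_def Y_def k'_def amp_angle_def)
    obtain g \<mu> where g: "orthonormal_family d d g"
      "\<And>i. i < d \<Longrightarrow> A 0 *\<^sub>v g i = of_real (\<mu> i) \<cdot>\<^sub>v g i"
      "\<And>i l. i \<le> l \<Longrightarrow> l < d \<Longrightarrow> \<mu> l \<le> \<mu> i"
      by (rule sorted_eigenbasis[OF A(2,1)[of 0]]) (rule le0, rule le0, rule that)
    have "0 \<le> \<mu> i" if i: "i < d" for i
    proof -
      have gi: "g i \<in> carrier_vec d" "g i \<bullet>c g i = 1" using g(1) i by (auto simp: orthonormal_family_def)
      then have "0 \<le> Re ((A 0 *\<^sub>v g i) \<bullet>c g i)" using assms(2)[of 0] by (auto simp: positive_op_def)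
      then show ?thesis unfolding g(2)[OF i] cscalar_prod_smult_left[OF gi(1,1)] gi(2) by simp
    qed
    then have "common_eigenbasis d 0 (B 0)"
      unfolding common_eigenbasis_def using g A(1)[of 0] B0
      by (intro conjI exI[of _ g] exI[of _ "\<lambda>_. \<mu>"]) auto
    then show ?case by (simp add: k'_def assms(6))
  next
    case (Suc N)
    let ?m = "k (Suc N)"
    have N: "Suc N \<le> n" "Suc N \<in> {1..n}" using Suc by auto
    have bounds: "1 / real ?m \<le> Re c \<and> Re c \<le> 1"
      if "eigenvalue (amp_round (A (Suc N)) (k' (Suc N))) c" for c
      using eigenvalue_loewner_bounds[OF A(1)[OF N(1)] eigenvalue_amp_round[OF A(1)[OF N(1)] that]]
        assms(4,5)[OF N(2)] by simp
    \<comment> \<open>The space carrying \<open>B N\<close> has dimension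
      \<open>k' (Suc N) * d\<close>, the size of \<open>amp_round (A (Suc N)) (k' (Suc N))\<close>;
      this ampliation takes the role of \<open>Y\<close> in the step.\<close>
    have "common_eigenbasis (?m * (k' (Suc N) * d)) (Suc N)
        (\<lambda>j. if j \<le> N then amp_square (B N j) ?m else Y (Suc N))"
      unfolding Y_def
      by (rule common_eigenbasis_step[OF Suc.IH self_adjoint_amp_round[OF A(1,2)[OF N(1)]] round[OF N(1)]
            assms(3)[OF N(2)] bounds]) (use N in auto)
    then have "common_eigenbasis (?m * (k' (Suc N) * d)) (Suc N) (B (Suc N))"
    proof (rule common_eigenbasis_cong)
      fix j assume j: "j \<le> Suc N"
      show "(if j \<le> N then amp_square (B N j) ?m else Y (Suc N)) = B (Suc N) j"
      proof (cases "j \<le> N")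
        case True
        then have "k'' (Suc N) j = ?m * k'' N j" by (simp add: k''_def mult.commute)
        then show ?thesis
          using True N amp_square_amp_square[OF Y[of j], of "k'' N j" ?m] by (simp add: B_def)
      next
        case False
        then have "j = Suc N" using j by simp
        then show ?thesis using amp_square_1[OF Y[OF N(1)]] by (simp add: B_def k''_def)
      qed
    qed
    then show ?case by (simp add: k'_Suc[of "Suc N"] mult.assoc)
  qed
  have K: "K = k' (Suc n)" by (simp add: assms(7) k'_eq)
  have mono: "monotone_family (K * d) n (B n)"
    unfolding K by (rule common_eigenbasis_imp_monotone_family[OF common[OF order_refl]])
  have "diag_blocks d K (B n j) (A j)" if j: "j \<le> n" for j
  proof -
    have "diag_blocks d (k j * k' j) (Y j) (A j)"
      unfolding Y_def using diag_blocks_amp_round[OF A(1)[OF j]] diag_blocks_amp_angle[OF round[OF j]]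
      by (rule diag_blocks_trans)
    then have "diag_blocks d (k'' n j * k' (Suc j)) (B n j) (A j)"
      unfolding B_def k'_Suc[symmetric] using diag_blocks_amp_square[OF Y[OF j]]
      by (rule diag_blocks_trans)
    \<comment> \<open>The product of all \<open>k l\<close> is split after index
      \<open>j\<close>.\<close>
    moreover have "k'' n j * k' (Suc j) = K"
    proof -
      have "k' (Suc n) = (\<Prod>l\<in>{0..<Suc j}. k l) * (\<Prod>l\<in>{Suc j..<Suc n}. k l)"
        unfolding k'_def using j by (intro prod.atLeastLessThan_concat[symmetric]) auto
      also have "{Suc j..<Suc n} = {j + 1..n}" by auto
      finally show ?thesis unfolding K by (simp add: k'_def k''_def mult.commute)
    qed
    ultimately show ?thesis by simp
  qed
  then have "totally_dilates d K n (B n) A"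
    using A(1) by (intro diag_blocks_imp_totally_dilates)
  moreover have "\<forall>j\<le>n. positive_op (K * d) (B n j)"
    using mono by (simp add: monotone_family_def)
  moreover have "B n = (\<lambda>j. amp_square (amp_angle (amp_round (A j) (\<Prod>l\<in>{0..<j}. k l)) (k j))
      (\<Prod>l\<in>{j+1..n}. k l))"
    by (simp add: fun_eq_iff B_def Y_def k'_def k''_def)
  ultimately show ?thesis using mono unfolding Let_def by auto
qed

end
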